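(* Let $\Sigma$ be a real $3\times 3$ matrix. Let $Z_0:\mathbb{R}^3\to\mathbb{C}^6$ be a periodic function with Fourier series $$Z_0(x)=Z_0^R(x)+iZ_0^I(x)=\sum_{w}\begin{pmatrix}X_w\\ Y_w\end{pmatrix}e^{ix\cdot w}=:\sum_w Z_{0,w}(x),\qquad X_w,Y_w\in\mathbb{C}^3,$$ where $w$ runs over nonzero wave vectors in $\mathbb{R}^3$ determined by the periodicity of $Z_0$, where $Z_0^R,Z_0^I$ are the real and imaginary parts, and $$Z_0^R(x)=\begin{pmatrix}E_0(x)\\ H_0(x)\end{pmatrix}.$$ Write $X_w=\sum_{d=1}^3a_{d,w}v_{d,w}$, $Y_w=\sum_{d=1}^3 b_{d,w}v_{d,w}$ and suppose $$\sum_w|w|\sum_{1\le d\le 3}\big(|a_{d,w}|+|b_{d,w}|\big)<\infty .$$ Assume that for each $w$ in the sum there are $\lambda_{k,w}\in\mathbb{C}$ and six linearly independent vectors $h^k_w=(a^k_{1,w},a^k_{2,w},a^k_{3,w},b^k_{1,w},b^k_{2,w},b^k_{3,w})^T\in\mathbb{C}^6$ ($1\le k\le 6$) such that for each $k$ and $1\le d\le 3$ $$\lambda_{k,w}\,b^k_{d,w}=i\,a^k_{d,w}\,\mu_{d,w},\qquad \lambda_{k,w}\,a^k_{d,w}=-i\,b^k_{d,w}\,\mu_{d,w}+i\sum_{j=1}^3a^k_{j,w}\,m_{d,j}.$$ Put $$Z^k_w(x)=e^{ix\cdot w}\begin{pmatrix}\sum_{d=1}^3a^k_{d,w}v_{d,w}\\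 \sum_{d=1}^3b^k_{d,w}v_{d,w}\end{pmatrix},\qquad Z_w(x,t)=\sum_{k=1}^6c^k_w\,Z^k_w(x)\,e^{i\lambda_{k,w}t},$$ where the coefficients $c^k_w$ are the unique complex numbers with $Z_w(x,0)=Z_{0,w}(x)$. Then the solution of $$\frac{\partial Z}{\partial t}=\mathbf{B}Z,\qquad Z(x,0)=Z_0(x)$$ is given by $$Z(x,t)=\sum_wZ_w(x,t)=:Z^R(x,t)+iZ^I(x,t).$$ Hence the real part $Z^R=(E^T,H^T)^T$ solves $$\frac{\partial E}{\partial t}=-\Sigma E+\operatorname{curl}H,\quad \frac{\partial H}{\partial t}=-\operatorname{curl}E,\quad E(x,0)=E_0(x),\quad H(x,0)=H_0(x).$$
   Context: Units are chosen with permittivity and permeability equal to $1$. $\Sigma$ is the (constant) conductivity matrix, and $\mathbf{B}$ acts on $\mathbb{C}^6$-valued fields $(U^T,W^T)^T$ by $$\mathbf{B}\begin{pmatrix}U\\ W\end{pmatrix}=\begin{pmatrix}-\Sigma U+\operatorname{curl}W\\ -\operatorname{curl}U\end{pmatrix},$$ with curl taken in $x$. For $w=(w_1,w_2,w_3)^T\in\mathbb{R}^3\setminus\{0\}$ put $|w|=\sqrt{w_1^2+w_2^2+w_3^2}$, $s_w=w_1+w_2+w_3$, $r_w=(w_2-w_3,w_3-w_1,w_1-w_2)^T$, $\nu_w=\sqrt2\,|r_w|/|w|$, and $\mu_{1,w}=0$, $\mu_{2,w}=-|w|$, $\mu_{3,w}=|w|$. Vectors $v_{d,w}\in\mathbb{C}^3$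 are defined as follows: $v_{1,w}=w/|w|$. If $r_w\ne0$, then for $d=2,3$ $$v_{d,w}=\frac1{\nu_w}\Big(\frac{s_w}{|w|^2}w-(1,1,1)^T-i\frac{\mu_{d,w}}{|w|^2}r_w\Big).$$ If $r_w=0$, so $w_1=w_2=w_3=\omega$, let $v_2=\frac1{\sqrt3}\big(\frac{1+i\sqrt3}2,\frac{1-i\sqrt3}2,-1\big)^T$ and set $v_{2,w}=v_2$ if $\omega\ge0$, $v_{2,w}=\overline{v_2}$ if $\omega<0$, and $v_{3,w}=\overline{v_{2,w}}$. The matrix $V_w=(v_{1,w},v_{2,w},v_{3,w})$ is unitary and $\operatorname{curl}(v_{d,w}e^{ix\cdot w})=\mu_{d,w}v_{d,w}e^{ix\cdot w}$. Finally $M_w=V_w^\dagger\Sigma V_w=(m_{d,k})_{1\le d,k\le3}$ ($m_{d,k}$ depends on $w$), where $\dagger$ is conjugate transpose. *)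

theory Defs
  imports "HOL-Analysis.Analysis"
begin

section \<open>Complex vectors and matrices\<close>

definition cvec :: "real^'n \<Rightarrow> complex^'n" where
  "cvec x = (\<chi> i. complex_of_real (x $ i))"

definition re_vec :: "complex^'n \<Rightarrow> real^'n" where
  "re_vec z = (\<chi> i. Re (z $ i))"

definition cnj_vec :: "complex^'n \<Rightarrow> complex^'n" where
  "cnj_vec z = (\<chi> i. cnj (z $ i))"

definition cmat :: "real^'n^'m \<Rightarrow> complex^'n^'m" where
  "cmat A = map_matrix complex_of_real A"

definition dagger :: "complex^'n^'m \<Rightarrow> complex^'m^'n" where
  "dagger A = transpose (map_matrix cnj A)"

text \<open>
  The index type \<open>3 + 3\<close> is the disjoint sum of two copies of \<open>3\<close>, so it has six elements;
  \<open>Inl\<close> indexes the first block of three components of a vector in $C^6$, \<open>Inr\<close> the second.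
\<close>

type_synonym C6 = "complex ^ (3 + 3)"

definition blk :: "complex^3 \<Rightarrow> complex^3 \<Rightarrow> C6" where
  "blk U W = (\<chi> i. case i of Inl d \<Rightarrow> U $ d | Inr d \<Rightarrow> W $ d)"

definition upper :: "C6 \<Rightarrow> complex^3" where
  "upper z = (\<chi> d. z $ Inl d)"

definition lower :: "C6 \<Rightarrow> complex^3" where
  "lower z = (\<chi> d. z $ Inr d)"

section \<open>Curl and the evolution equations\<close>

definition pd :: "3 \<Rightarrow> (real^3 \<Rightarrow> 'b::real_normed_vector) \<Rightarrow> real^3 \<Rightarrow> 'b" where
  "pd j f x = frechet_derivative f (at x) (axis j 1)"

text \<open>
  The value of \<open>curl F x\<close> is meaningful only where \<open>F\<close> is differentiable; every use below is for
  fields which are required to be continuously differentiable.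
\<close>

definition curl :: "(real^3 \<Rightarrow> 'a::real_normed_vector^3) \<Rightarrow> real^3 \<Rightarrow> 'a^3" where
  "curl F x = vector
     [pd 2 F x $ 3 - pd 3 F x $ 2,
      pd 3 F x $ 1 - pd 1 F x $ 3,
      pd 1 F x $ 2 - pd 2 F x $ 1]"

definition C1_on :: "('a::real_normed_vector \<Rightarrow> 'b::real_normed_vector) \<Rightarrow> 'a set \<Rightarrow> bool" where
  "C1_on f S \<longleftrightarrow>
     (\<exists>f'. (\<forall>x\<in>S. (f has_derivative blinfun_apply (f' x)) (at x within S)) \<and> continuous_on S f')"

definition periodic :: "(3 \<Rightarrow> real^3) \<Rightarrow> (real^3 \<Rightarrow> 'b) \<Rightarrow> bool" where
  "periodic p f \<longleftrightarrow> (\<forall>j x. f (x + p j) = f x)"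

definition maxwell_op :: "real^3^3 \<Rightarrow> (real^3 \<Rightarrow> C6) \<Rightarrow> real^3 \<Rightarrow> C6" where
  "maxwell_op S Z x =
     blk (- (cmat S *v upper (Z x)) + curl (\<lambda>y. lower (Z y)) x)
         (- curl (\<lambda>y. upper (Z y)) x)"

text \<open>
  Classical (continuously differentiable), spatially periodic solutions for times in \<open>T\<close>.  The
  time derivative is taken within \<open>T\<close>, hence is one-sided at an endpoint of \<open>T\<close>.
\<close>

definition solves_maxwell ::
  "real^3^3 \<Rightarrow> (3 \<Rightarrow> real^3) \<Rightarrow> real set \<Rightarrow> (real^3 \<Rightarrow> C6) \<Rightarrow> (real^3 \<Rightarrow> real \<Rightarrow> C6) \<Rightarrow> bool" where
  "solves_maxwell S p T Z0 Z \<longleftrightarrow>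
     (\<forall>t\<in>T. periodic p (\<lambda>x. Z x t)) \<and>
     C1_on (\<lambda>(x, t). Z x t) (UNIV \<times> T) \<and>
     (\<forall>x. \<forall>t\<in>T. ((\<lambda>s. Z x s) has_vector_derivative maxwell_op S (\<lambda>y. Z y t) x) (at t within T)) \<and>
     (\<forall>x. Z x 0 = Z0 x)"

definition solves_real_maxwell ::
  "real^3^3 \<Rightarrow> (3 \<Rightarrow> real^3) \<Rightarrow> real set \<Rightarrow> (real^3 \<Rightarrow> real^3) \<Rightarrow> (real^3 \<Rightarrow> real^3)
     \<Rightarrow> (real^3 \<Rightarrow> real \<Rightarrow> real^3) \<Rightarrow> (real^3 \<Rightarrow> real \<Rightarrow> real^3) \<Rightarrow> bool" where
  "solves_real_maxwell S p T E0 H0 E H \<longleftrightarrow>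
     (\<forall>t\<in>T. periodic p (\<lambda>x. E x t) \<and> periodic p (\<lambda>x. H x t)) \<and>
     C1_on (\<lambda>(x, t). E x t) (UNIV \<times> T) \<and> C1_on (\<lambda>(x, t). H x t) (UNIV \<times> T) \<and>
     (\<forall>x. \<forall>t\<in>T.
        ((\<lambda>s. E x s) has_vector_derivative (- (S *v E x t) + curl (\<lambda>y. H y t) x)) (at t within T) \<and>
        ((\<lambda>s. H x s) has_vector_derivative (- curl (\<lambda>y. E y t) x)) (at t within T)) \<and>
     (\<forall>x. E x 0 = E0 x \<and> H x 0 = H0 x)"

section \<open>Wave vectors and curl eigenvectors\<close>

text \<open>
  Nonzero \<open>w\<close> for which $e^{i x \cdot w}$ is periodic with periods \<open>p 1\<close>, \<open>p 2\<close>, \<open>p 3\<close>.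
\<close>

definition wave_vectors :: "(3 \<Rightarrow> real^3) \<Rightarrow> (real^3) set" where
  "wave_vectors p = {w. w \<noteq> 0 \<and> (\<forall>j. \<exists>n::int. w \<bullet> p j = 2 * pi * of_int n)}"

definition s_of :: "real^3 \<Rightarrow> real" where
  "s_of w = w $ 1 + w $ 2 + w $ 3"

definition r_of :: "real^3 \<Rightarrow> real^3" where
  "r_of w = vector [w $ 2 - w $ 3, w $ 3 - w $ 1, w $ 1 - w $ 2]"

definition nu :: "real^3 \<Rightarrow> real" where
  "nu w = sqrt 2 * norm (r_of w) / norm w"

definition mu :: "3 \<Rightarrow> real^3 \<Rightarrow> real" where
  "mu d w = (if d = 1 then 0 else if d = 2 then - norm w else norm w)"

definition v2_diag :: "complex^3" where
  "v2_diag = complex_of_real (1 / sqrt 3) *s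
     vector [(1 + \<i> * complex_of_real (sqrt 3)) / 2, (1 - \<i> * complex_of_real (sqrt 3)) / 2, -1]"

text \<open>
  In the case \<open>r_of w = 0\<close> all components of \<open>w\<close> are equal, so \<open>w $ 1\<close> is their common value.
\<close>

definition v :: "3 \<Rightarrow> real^3 \<Rightarrow> complex^3" where
  "v d w =
     (if d = 1 then cvec (w /\<^sub>R norm w)
      else if r_of w \<noteq> 0 then
        complex_of_real (1 / nu w) *s
          (cvec ((s_of w / (norm w)\<^sup>2) *\<^sub>R w) - vector [1, 1, 1]
             - (\<i> * complex_of_real (mu d w / (norm w)\<^sup>2)) *s cvec (r_of w))
      else
        (let v2 = (if w $ 1 \<ge> 0 then v2_diag else cnj_vec v2_diag)
         in if d = 2 then v2 else cnj_vec v2))"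

definition Vmat :: "real^3 \<Rightarrow> complex^3^3" where
  "Vmat w = (\<chi> i d. v d w $ i)"

definition Mmat :: "real^3^3 \<Rightarrow> real^3 \<Rightarrow> complex^3^3" where
  "Mmat S w = dagger (Vmat w) ** cmat S ** Vmat w"

section \<open>Plane waves\<close>

definition plane_wave :: "real^3 \<Rightarrow> complex^3 \<Rightarrow> complex^3 \<Rightarrow> real^3 \<Rightarrow> C6" where
  "plane_wave w X Y x = exp (\<i> * complex_of_real (x \<bullet> w)) *s blk X Y"

text \<open>
  A vector \<open>h = (a\<^sub>1, a\<^sub>2, a\<^sub>3, b\<^sub>1, b\<^sub>2, b\<^sub>3)\<close> holds the coefficients of the two blocks in the basis
  \<open>v 1 w\<close>, \<open>v 2 w\<close>, \<open>v 3 w\<close>.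
\<close>

definition eigen_eqs :: "real^3^3 \<Rightarrow> real^3 \<Rightarrow> complex \<Rightarrow> C6 \<Rightarrow> bool" where
  "eigen_eqs S w l h \<longleftrightarrow>
     (let a = upper h; b = lower h in
      \<forall>d::3. l * b $ d = \<i> * a $ d * complex_of_real (mu d w) \<and>
             l * a $ d = - \<i> * b $ d * complex_of_real (mu d w)
                         + \<i> * (\<Sum>j\<in>UNIV. a $ j * Mmat S w $ d $ j))"

definition eigen_wave :: "real^3 \<Rightarrow> C6 \<Rightarrow> real^3 \<Rightarrow> C6" where
  "eigen_wave w h =
     plane_wave w (\<Sum>d\<in>UNIV. upper h $ d *s v d w) (\<Sum>d\<in>UNIV. lower h $ d *s v d w)"

definition wave_mode ::
  "real^3 \<Rightarrow> (6 \<Rightarrow> complex) \<Rightarrow> (6 \<Rightarrow> C6) \<Rightarrow> (6 \<Rightarrow> complex) \<Rightarrow> real^3 \<Rightarrow> real \<Rightarrow> C6" where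
  "wave_mode w lam h c x t =
     (\<Sum>k\<in>UNIV. (c k * exp (\<i> * lam k * complex_of_real t)) *s eigen_wave w (h k) x)"

end

theory Submission
  imports Defs
begin

text \<open>
  Write the equations as a first-order system
  \<open>\<partial>\<^sub>t Z = damping S Z + (\<Sum>j. flux (axis j 1) (\<partial>\<^sub>j Z))\<close>. The matrices \<open>flux (axis j 1)\<close> are symmetric
  for the real inner product of $C^6$, because $u \cdot (w \times u')$ is antisymmetric in $u$
  and $u'$ and the two curls enter with opposite signs. Hence only the zeroth-order term
  \<open>damping S\<close> can change the energy, and energy grows at most exponentially at a rate that depends
  on \<open>S\<close> alone. This one fact is used twice.

  For existence, unitarity of \<open>V\<^sub>w\<close> and the eigenvector equations of curl turn the algebraic equations
  for \<open>\<lambda>\<close>, \<open>a\<close>, \<open>b\<close> into the statement that the amplitude of each mode solves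
  \<open>\<zeta>' = damping S \<zeta> + i flux w \<zeta>\<close>. The exponents \<open>\<lambda>\<close> and the coefficients \<open>c\<close> come with no bound
  that is uniform in \<open>w\<close>, so the series cannot be estimated term by term in \<open>k\<close>. The energy estimate
  (lemma \<open>amplitude_bound\<close>) replaces this: the amplitude at time \<open>t\<close> is at most
  $e^{K|t|}$ times the initial one, with the same $K$ for every wave vector. With the decay
  assumption, the series of first derivatives then converges locally uniformly, and
  differentiation term by term (\<open>has_derivative_infsum\<close>) shows that the sum is continuously
  differentiable and solves the system (\<open>superposition_solves_maxwell\<close>).

  For uniqueness, the difference of two solutions is integrated over a period cell. The flux terms
  are directional derivatives of periodic functions, whose integrals over the cell vanish, so the
  same growth estimate forces the energy of the difference to stay zero
  (\<open>periodic_symmetric_system_zero\<close>). Integrating over cells with an arbitrary corner gives the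
  vanishing at every point without any reduction modulo the lattice.

  The real part is handled by applying a bounded linear map, since \<open>S\<close> is real.
\<close>

section \<open>Regularity of sums over arbitrary index sets\<close>

text \<open>
  The remainder quotients of the summands are bounded by \<open>2 * M i\<close>, by the mean value inequality, so
  their sum converges uniformly and its limit at \<open>x\<close> may be taken term by term.
\<close>

lemma has_derivative_infsum:
  fixes f :: "'i \<Rightarrow> 'a::real_normed_vector \<Rightarrow> 'b::banach"
    and f' :: "'i \<Rightarrow> 'a \<Rightarrow> 'a \<Rightarrow>\<^sub>L 'b"
  assumes U: "convex U" "x \<in> U"
    and deriv: "\<And>i x. i \<in> I \<Longrightarrow> x \<in> U \<Longrightarrow> (f i has_derivative blinfun_apply (f' i x)) (at x within U)"
    and bound: "\<And>i x. i \<in> I \<Longrightarrow> x \<in> U \<Longrightarrow> norm (f' i x) \<le> M i"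
    and M: "M summable_on I"
    and conv: "\<And>x. x \<in> U \<Longrightarrow> (\<lambda>i. f i x) summable_on I"
  shows "((\<lambda>y. \<Sum>\<^sub>\<infinity>i\<in>I. f i y) has_derivative blinfun_apply (\<Sum>\<^sub>\<infinity>i\<in>I. f' i x)) (at x within U)"
proof -
  define q where "q i y = (1 / norm (y - x)) *\<^sub>R (f i y - (f i x + f' i x (y - x)))" for i y
  have sum_f': "(\<lambda>i. f' i x) summable_on I"
    by (rule abs_summable_summable, rule Infinite_Sum.abs_summable_on_comparison_test'[OF M])
      (rule bound[OF _ U(2)])
  have q_bound: "norm (q i y) \<le> 2 * M i" if "i \<in> I" "y \<in> U" for i y
  proof -
    have "norm (f i y - f i x) \<le> M i * norm (y - x)"
      using differentiable_bound[OF U(1) deriv[OF that(1)] _ that(2) U(2)] bound[OF that(1)]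
      by (simp add: norm_blinfun.rep_eq)
    moreover have "norm (f' i x (y - x)) \<le> M i * norm (y - x)"
      using norm_blinfun[of "f' i x" "y - x"] bound[OF that(1) U(2)]
      by (meson mult_right_mono norm_ge_zero order_trans)
    ultimately have "norm (f i y - (f i x + f' i x (y - x))) \<le> 2 * M i * norm (y - x)"
      using norm_triangle_ineq4[of "f i y - f i x" "f' i x (y - x)"] by (simp add: algebra_simps)
    moreover have "0 \<le> M i"
      using bound[OF that(1) U(2)] norm_ge_zero order_trans by blast
    ultimately show ?thesis
      by (cases "y = x") (auto simp: q_def divide_simps)
  qed
  have q_lim: "((\<lambda>y. \<Sum>\<^sub>\<infinity>i\<in>I. q i y) \<longlongrightarrow> 0) (at x within U)"
  proof (rule swap_uniform_limit)
    show "\<forall>\<^sub>F F in finite_subsets_at_top I. ((\<lambda>y. \<Sum>i\<in>F. q i y) \<longlongrightarrow> 0) (at x within U)"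
    proof (rule eventually_finite_subsets_at_top_weakI)
      fix F assume "finite F" "F \<subseteq> I"
      then have "(q i \<longlongrightarrow> 0) (at x within U)" if "i \<in> F" for i
        using deriv[OF _ U(2), of i] that unfolding has_derivative_within q_def by blast
      then show "((\<lambda>y. \<Sum>i\<in>F. q i y) \<longlongrightarrow> 0) (at x within U)"
        using tendsto_sum[of F q "\<lambda>_. 0" "at x within U"] by simp
    qed
    show "uniform_limit U (\<lambda>F y. \<Sum>i\<in>F. q i y) (\<lambda>y. \<Sum>\<^sub>\<infinity>i\<in>I. q i y) (finite_subsets_at_top I)"
      using q_bound M by (intro Weierstrass_m_test_general[where M = "\<lambda>i. 2 * M i"])
        (auto intro: summable_on_cmult_right)
  qed auto
  have q_sum: "(\<Sum>\<^sub>\<infinity>i\<in>I. q i y) = (1 / norm (y - x)) *\<^sub>R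
      ((\<Sum>\<^sub>\<infinity>i\<in>I. f i y) - ((\<Sum>\<^sub>\<infinity>i\<in>I. f i x) + (\<Sum>\<^sub>\<infinity>i\<in>I. f' i x) (y - x)))" if "y \<in> U" for y
  proof -
    have "((\<lambda>i. f' i x (y - x)) has_sum (\<Sum>\<^sub>\<infinity>i\<in>I. f' i x) (y - x)) I"
      by (intro has_sum_bounded_linear[OF blinfun.bounded_linear_left] has_sum_infsum sum_f')
    then have "((\<lambda>i. f i y + - (f i x + f' i x (y - x))) has_sum
       ((\<Sum>\<^sub>\<infinity>i\<in>I. f i y) + - ((\<Sum>\<^sub>\<infinity>i\<in>I. f i x) + (\<Sum>\<^sub>\<infinity>i\<in>I. f' i x) (y - x)))) I"
      by (intro has_sum_add has_sum_infsum conv that U(2)) 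
         (simp only: has_sum_uminus minus_minus, intro has_sum_add has_sum_infsum conv that U(2))
    then have "((\<lambda>i. f i y - (f i x + f' i x (y - x))) has_sum
       ((\<Sum>\<^sub>\<infinity>i\<in>I. f i y) - ((\<Sum>\<^sub>\<infinity>i\<in>I. f i x) + (\<Sum>\<^sub>\<infinity>i\<in>I. f' i x) (y - x)))) I"
      by (simp only: add_uminus_conv_diff)
    then show ?thesis
      unfolding q_def
      by (intro infsumI has_sum_bounded_linear[OF bounded_linear_scaleR_right])
  qed
  have "((\<lambda>y. (1 / norm (y - x)) *\<^sub>R
      ((\<Sum>\<^sub>\<infinity>i\<in>I. f i y) - ((\<Sum>\<^sub>\<infinity>i\<in>I. f i x) + (\<Sum>\<^sub>\<infinity>i\<in>I. f' i x) (y - x)))) \<longlongrightarrow> 0) (at x within U)"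
    by (rule Lim_transform_within[OF q_lim zero_less_one]) (auto simp: q_sum)
  then show ?thesis
    unfolding has_derivative_within by (simp add: blinfun.bounded_linear_right)
qed

lemma continuous_on_infsum:
  fixes f :: "'i \<Rightarrow> 'a::topological_space \<Rightarrow> 'b::banach"
  assumes cont: "\<And>i. i \<in> I \<Longrightarrow> continuous_on U (f i)"
    and bound: "\<And>i x. i \<in> I \<Longrightarrow> x \<in> U \<Longrightarrow> norm (f i x) \<le> M i"
    and M: "M summable_on I"
  shows "continuous_on U (\<lambda>x. \<Sum>\<^sub>\<infinity>i\<in>I. f i x)"
proof (rule uniform_limit_theorem)
  show "uniform_limit U (\<lambda>F x. \<Sum>i\<in>F. f i x) (\<lambda>x. \<Sum>\<^sub>\<infinity>i\<in>I. f i x) (finite_subsets_at_top I)"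
    using bound M by (rule Weierstrass_m_test_general)
  show "\<forall>\<^sub>F F in finite_subsets_at_top I. continuous_on U (\<lambda>x. \<Sum>i\<in>F. f i x)"
    using cont by (intro eventually_finite_subsets_at_top_weakI continuous_on_sum) auto
qed auto

section \<open>Exponential growth bound\<close>

text \<open>
  The bound on \<open>e'\<close> is two-sided so that the estimate also holds backwards in time.
\<close>

lemma exp_growth_bound:
  fixes e :: "real \<Rightarrow> real"
  assumes T: "is_interval T" "0 \<in> T" "t \<in> T"
    and deriv: "\<And>s. s \<in> T \<Longrightarrow> (e has_real_derivative e' s) (at s within T)"
    and bound: "\<And>s. s \<in> T \<Longrightarrow> \<bar>e' s\<bar> \<le> K * e s"
  shows "e t \<le> e 0 * exp (K * \<bar>t\<bar>)"
proof -
  \<comment> \<open>The sign of \<open>t\<close> selects the integrating factor that makes \<open>g\<close> decrease when moving from 0 to \<open>t\<close>.\<close>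
  define c where "c = K * sgn t"
  define g where "g s = e s * exp (- c * s)" for s
  define g' where "g' s = (e' s - c * e s) * exp (- c * s)" for s
  have sub: "closed_segment 0 t \<subseteq> T"
    using T by (simp add: closed_segment_subset is_interval_convex)
  have g: "(g has_derivative (\<lambda>h. g' s * h)) (at s within closed_segment 0 t)"
    if "s \<in> closed_segment 0 t" for s
  proof -
    have "(e has_real_derivative e' s) (at s within closed_segment 0 t)"
      using deriv[of s] that sub DERIV_subset by blast
    then have "(g has_real_derivative g' s) (at s within closed_segment 0 t)"
      unfolding g_def g'_def by (auto intro!: derivative_eq_intros simp: algebra_simps)
    then show ?thesis
      by (simp add: has_field_derivative_def)
  qed
  have "\<exists>s\<in>closed_segment 0 t. g t - g 0 = g' s * t"
  proof (cases "0 \<le> t")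
    case True
    then show ?thesis
      using mvt_very_simple[of 0 t g "\<lambda>s h. g' s * h"] g by (auto simp: closed_segment_eq_real_ivl)
  next
    case False
    then have "\<exists>s\<in>{t..0}. g 0 - g t = g' s * (0 - t)"
      using g by (intro mvt_very_simple) (auto simp: closed_segment_eq_real_ivl)
    then show ?thesis
      using False by (force simp: closed_segment_eq_real_ivl algebra_simps)
  qed
  then obtain s where s: "s \<in> T" "g t - g 0 = g' s * t"
    using sub by blast
  have "(e' s - c * e s) * t \<le> 0"
    using bound[OF s(1)] by (cases t "0::real" rule: linorder_cases)
      (auto simp: c_def mult_nonneg_nonpos mult_nonpos_nonneg)
  then have "g' s * t \<le> 0"
    unfolding g'_def using mult_nonpos_nonneg[of "(e' s - c * e s) * t" "exp (- c * s)"]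
    by (simp add: mult_ac)
  then have "e t * exp (- c * t) \<le> e 0"
    using s(2) by (simp add: g_def)
  moreover have "c * t = K * \<bar>t\<bar>"
    by (simp add: c_def abs_sgn mult_ac)
  ultimately show ?thesis
    by (simp add: exp_minus divide_simps)
qed

section \<open>Uniqueness for periodic symmetric systems\<close>

text \<open>
  The coordinates range over \<open>real \<times> real \<times> real\<close> rather than \<open>real^3\<close> because the theorems on
  iterated integrals are about product types.
\<close>

definition cell_point :: "(3 \<Rightarrow> real^3) \<Rightarrow> real^3 \<Rightarrow> real \<times> real \<times> real \<Rightarrow> real^3" where
  "cell_point p x = (\<lambda>(r, s, t). x + r *\<^sub>R p 1 + s *\<^sub>R p 2 + t *\<^sub>R p 3)"

abbreviation unit_cell :: "(real \<times> real \<times> real) set" where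
  "unit_cell \<equiv> cbox (0, 0, 0) (1, 1, 1)"

lemma continuous_on_cell_point [continuous_intros]:
  "continuous_on A f \<Longrightarrow> continuous_on A (\<lambda>x. cell_point p y (f x))"
  unfolding cell_point_def case_prod_beta by (intro continuous_intros)

lemma periods_span:
  fixes p :: "3 \<Rightarrow> real^3"
  assumes "inj p" "independent (range p)"
  obtains c where "e = (\<Sum>j\<in>UNIV. c j *\<^sub>R p j)"
proof -
  have "card (range p) = 3"
    using assms(1) by (simp add: card_image)
  then have "UNIV \<subseteq> span (range p)"
    using card_ge_dim_independent[of "range p" UNIV] assms(2) by simp
  then have "e \<in> range (\<lambda>u. \<Sum>v\<in>range p. u v *\<^sub>R v)"
    using span_finite[of "range p"] by auto
  then obtain u where "e = (\<Sum>v\<in>range p. u v *\<^sub>R v)"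
    by (elim imageE)
  also have "\<dots> = (\<Sum>j\<in>UNIV. u (p j) *\<^sub>R p j)"
    by (subst sum.reindex[OF assms(1)]) (simp only: o_def)
  finally show thesis ..
qed

lemma integral_periodic_derivative_line:
  fixes \<phi> :: "real^3 \<Rightarrow> real"
  assumes deriv: "\<And>x. (\<phi> has_derivative \<phi>' x) (at x)" and per: "periodic p \<phi>"
  shows "integral {0..1} (\<lambda>s. \<phi>' (y + s *\<^sub>R p j) (p j)) = 0"
proof -
  have "((\<lambda>s. \<phi> (y + s *\<^sub>R p j)) has_vector_derivative \<phi>' (y + s *\<^sub>R p j) (p j)) (at s within {0..1})" for s
  proof -
    have "((\<lambda>s. \<phi> (y + s *\<^sub>R p j)) has_derivative (\<lambda>h. \<phi>' (y + s *\<^sub>R p j) (h *\<^sub>R p j))) (at s within {0..1})"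
      by (rule has_derivative_compose[OF _ deriv, where f = "\<lambda>s. y + s *\<^sub>R p j"])
         (auto intro!: derivative_eq_intros)
    then show ?thesis
      unfolding has_vector_derivative_def
      using linear_simps(5)[OF has_derivative_bounded_linear[OF deriv]] by simp
  qed
  then have "((\<lambda>s. \<phi>' (y + s *\<^sub>R p j) (p j)) has_integral \<phi> (y + 1 *\<^sub>R p j) - \<phi> (y + 0 *\<^sub>R p j)) {0..1}"
    by (intro fundamental_theorem_of_calculus) auto
  then show ?thesis
    using per by (simp add: periodic_def integral_unique)
qed

text \<open>
  Along a period the integrand is an exact derivative with equal end values; Fubini's theorem allows
  that coordinate to be integrated first. Every other direction is a combination of periods.
\<close>

lemma integral_periodic_derivative_cell:
  fixes \<phi> :: "real^3 \<Rightarrow> real"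
  assumes p: "inj p" "independent (range p)"
    and deriv: "\<And>x. (\<phi> has_derivative \<phi>' x) (at x)" and per: "periodic p \<phi>"
    and cont: "\<And>e. continuous_on UNIV (\<lambda>x. \<phi>' x e)"
  shows "integral unit_cell (\<lambda>s. \<phi>' (cell_point p x s) e) = 0"
proof -
  have cont': "continuous_on A (\<lambda>z. \<phi>' (f z) e)" if "continuous_on A f" for A :: "'c::topological_space set" and f e
    using continuous_on_compose2[OF cont that] by auto
  have cell_cont: "continuous_on A (\<lambda>z. \<phi>' (cell_point p x (f z)) e)" if "continuous_on A f"
    for A :: "'c::topological_space set" and f e
    by (intro cont' continuous_on_cell_point that)
  note line = integral_periodic_derivative_line[OF deriv per]
  have 1: "integral unit_cell (\<lambda>s. \<phi>' (cell_point p x s) (p 1)) = 0"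
  proof -
    have "integral unit_cell (\<lambda>s. \<phi>' (cell_point p x s) (p 1)) =
       integral (cbox 0 1) (\<lambda>r. integral (cbox (0, 0) (1, 1)) (\<lambda>u. \<phi>' (cell_point p x (r, u)) (p 1)))"
      by (rule integral_prod_continuous) (rule cell_cont, intro continuous_intros)
    also have "\<dots> = integral (cbox (0, 0) (1, 1)) (\<lambda>u. integral (cbox 0 1) (\<lambda>r. \<phi>' (cell_point p x (r, u)) (p 1)))"
      by (rule integral_swap_continuous) (unfold case_prod_unfold, rule cell_cont, intro continuous_intros)
    also have "\<dots> = integral (cbox (0, 0) (1, 1)) (\<lambda>u :: real \<times> real. 0)"
    proof (rule integral_cong)
      fix u :: "real \<times> real"
      show "integral (cbox 0 1) (\<lambda>r. \<phi>' (cell_point p x (r, u)) (p 1)) = 0"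
        using line[of "x + fst u *\<^sub>R p 2 + snd u *\<^sub>R p 3" 1]
        by (simp add: cell_point_def case_prod_beta add_ac)
    qed
    finally show ?thesis by simp
  qed
  have 2: "integral unit_cell (\<lambda>s. \<phi>' (cell_point p x s) (p 2)) = 0"
  proof -
    have "integral unit_cell (\<lambda>s. \<phi>' (cell_point p x s) (p 2)) =
       integral (cbox 0 1) (\<lambda>r. integral (cbox (0, 0) (1, 1)) (\<lambda>u. \<phi>' (cell_point p x (r, u)) (p 2)))"
      by (rule integral_prod_continuous) (rule cell_cont, intro continuous_intros)
    also have "\<dots> = integral (cbox 0 1) (\<lambda>r :: real. 0)"
    proof (rule integral_cong)
      fix r
      have "integral (cbox (0, 0) (1, 1)) (\<lambda>u. \<phi>' (cell_point p x (r, u)) (p 2)) =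
          integral (cbox 0 1) (\<lambda>s. integral (cbox 0 1) (\<lambda>t. \<phi>' (cell_point p x (r, s, t)) (p 2)))"
        by (rule integral_prod_continuous) (rule cell_cont, intro continuous_intros)
      also have "\<dots> = integral (cbox 0 1) (\<lambda>t. integral (cbox 0 1) (\<lambda>s. \<phi>' (cell_point p x (r, s, t)) (p 2)))"
        by (rule integral_swap_continuous) (unfold case_prod_unfold, rule cell_cont, intro continuous_intros)
      also have "\<dots> = integral (cbox 0 1) (\<lambda>t :: real. 0)"
      proof (rule integral_cong)
        fix t
        show "integral (cbox 0 1) (\<lambda>s. \<phi>' (cell_point p x (r, s, t)) (p 2)) = 0"
          using line[of "x + r *\<^sub>R p 1 + t *\<^sub>R p 3" 2] by (simp add: cell_point_def add_ac)
      qed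
      finally show "integral (cbox (0, 0) (1, 1)) (\<lambda>u. \<phi>' (cell_point p x (r, u)) (p 2)) = 0" by simp
    qed
    finally show ?thesis by simp
  qed
  have 3: "integral unit_cell (\<lambda>s. \<phi>' (cell_point p x s) (p 3)) = 0"
  proof -
    have "integral unit_cell (\<lambda>s. \<phi>' (cell_point p x s) (p 3)) =
       integral (cbox 0 1) (\<lambda>r. integral (cbox (0, 0) (1, 1)) (\<lambda>u. \<phi>' (cell_point p x (r, u)) (p 3)))"
      by (rule integral_prod_continuous) (rule cell_cont, intro continuous_intros)
    also have "\<dots> = integral (cbox 0 1) (\<lambda>r :: real. 0)"
    proof (rule integral_cong)
      fix r
      have "integral (cbox (0, 0) (1, 1)) (\<lambda>u. \<phi>' (cell_point p x (r, u)) (p 3)) =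
          integral (cbox 0 1) (\<lambda>s. integral (cbox 0 1) (\<lambda>t. \<phi>' (cell_point p x (r, s, t)) (p 3)))"
        by (rule integral_prod_continuous) (rule cell_cont, intro continuous_intros)
      also have "\<dots> = integral (cbox 0 1) (\<lambda>t :: real. 0)"
      proof (rule integral_cong)
        fix s
        show "integral (cbox 0 1) (\<lambda>t. \<phi>' (cell_point p x (r, s, t)) (p 3)) = 0"
          using line[of "x + r *\<^sub>R p 1 + s *\<^sub>R p 2" 3] by (simp add: cell_point_def add_ac)
      qed
      finally show "integral (cbox (0, 0) (1, 1)) (\<lambda>u. \<phi>' (cell_point p x (r, u)) (p 3)) = 0" by simp
    qed
    finally show ?thesis by simp
  qed
  have zero: "integral unit_cell (\<lambda>s. \<phi>' (cell_point p x s) (p j)) = 0" for j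
    using 1 2 3 exhaust_3[of j] by metis
  obtain c where e: "e = (\<Sum>j\<in>UNIV. c j *\<^sub>R p j)"
    using periods_span[OF p] .
  have "\<phi>' z e = (\<Sum>j\<in>UNIV. c j * \<phi>' z (p j))" for z
  proof -
    interpret bounded_linear "\<phi>' z"
      using deriv by (rule has_derivative_bounded_linear)
    show ?thesis
      unfolding e by (simp add: sum scaleR)
  qed
  then have "integral unit_cell (\<lambda>s. \<phi>' (cell_point p x s) e) =
      integral unit_cell (\<lambda>s. \<Sum>j\<in>UNIV. c j * \<phi>' (cell_point p x s) (p j))" by simp
  also have "\<dots> = (\<Sum>j\<in>UNIV. integral unit_cell (\<lambda>s. c j * \<phi>' (cell_point p x s) (p j)))"
    by (intro integral_sum finite integrable_continuous continuous_intros cont')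
  also have "\<dots> = 0"
    using zero by simp
  finally show ?thesis .
qed

text \<open>
  The time set may be a single point, where the derivative within \<open>UNIV \<times> T\<close> is not unique. Its
  restriction to spatial directions still is.
\<close>

lemma partial_derivative_space_time:
  assumes "((\<lambda>(x, t). D x t) has_derivative F) (at (x, t) within UNIV \<times> T)" "t \<in> T"
  shows "((\<lambda>y. D y t) has_derivative (\<lambda>h. F (h, 0))) (at x)"
    and "pd j (\<lambda>y. D y t) x = F (axis j 1, 0)"
proof -
  have "((\<lambda>y. (y, t)) has_derivative (\<lambda>h. (h, 0))) (at x within UNIV)"
    by (auto intro!: derivative_eq_intros)
  moreover have "((\<lambda>(x, t). D x t) has_derivative F) (at (x, t) within range (\<lambda>y. (y, t)))"
    using assms by (intro has_derivative_subset[OF assms(1)]) auto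
  ultimately show 1: "((\<lambda>y. D y t) has_derivative (\<lambda>h. F (h, 0))) (at x)"
    using has_derivative_in_compose[of "\<lambda>y. (y, t)" _ x UNIV "\<lambda>(x, t). D x t" F] by simp
  show "pd j (\<lambda>y. D y t) x = F (axis j 1, 0)"
    unfolding pd_def using frechet_derivative_at[OF 1] by metis
qed

text \<open>
  By symmetry, twice the inner product of \<open>D\<close> with \<open>A j (\<partial>\<^sub>j D)\<close> is the derivative of
  \<open>D \<bullet> A j D\<close> in direction \<open>j\<close>. Its integral over a period cell vanishes, which leaves only the
  contribution of \<open>L\<close> to the growth of the energy.
\<close>

theorem periodic_symmetric_system_zero:
  fixes D :: "real^3 \<Rightarrow> real \<Rightarrow> 'b::euclidean_space"
  assumes p: "inj p" "independent (range p)"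
    and T: "is_interval T" "0 \<in> T"
    and L: "bounded_linear L"
    and A: "\<And>j. bounded_linear (A j)" "\<And>j y z. y \<bullet> A j z = A j y \<bullet> z"
    and C1: "C1_on (\<lambda>(x, t). D x t) (UNIV \<times> T)"
    and per: "\<And>t. t \<in> T \<Longrightarrow> periodic p (\<lambda>x. D x t)"
    and ode: "\<And>x t. t \<in> T \<Longrightarrow> ((\<lambda>s. D x s) has_vector_derivative
        (L (D x t) + (\<Sum>j\<in>UNIV. A j (pd j (\<lambda>y. D y t) x)))) (at t within T)"
    and init: "\<And>x. D x 0 = 0"
    and t: "t \<in> T"
  shows "D x t = 0"
proof -
  obtain D' where D': "\<And>x t. t \<in> T \<Longrightarrow> ((\<lambda>(x, t). D x t) has_derivative blinfun_apply (D' (x, t))) (at (x, t) within UNIV \<times> T)"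
    and D'_cont: "continuous_on (UNIV \<times> T) D'"
    using C1 unfolding C1_on_def by auto
  have D_cont: "continuous_on (UNIV \<times> T) (\<lambda>(x, t). D x t)"
    using D' by (intro has_derivative_continuous_on[where f' = "\<lambda>z. blinfun_apply (D' z)"]) auto
  interpret L: bounded_linear L by fact
  interpret A: bounded_linear "A j" for j by fact
  have cont_D: "continuous_on X (\<lambda>z. D (f z) (g z))" if "continuous_on X f" "continuous_on X g" "g ` X \<subseteq> T"
    for X :: "'z::topological_space set" and f g
    using continuous_on_compose2[OF D_cont continuous_on_Pair[OF that(1,2)]] that(3) by auto
  have cont_D': "continuous_on X (\<lambda>z. D' (f z, g z) h)" if "continuous_on X f" "continuous_on X g" "g ` X \<subseteq> T"
    for X :: "'z::topological_space set" and f g h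
    using continuous_on_compose2[OF D'_cont continuous_on_Pair[OF that(1,2)]] that(3)
    by (intro continuous_intros) auto
  \<comment> \<open>The cell has its corner at the point \<open>x\<close> where the claim is made.\<close>
  define P where "P = cell_point p x"
  define R where "R y t = L (D y t) + (\<Sum>j\<in>UNIV. A j (D' (y, t) (axis j 1, 0)))" for y t
  define e where "e t = integral unit_cell (\<lambda>s. D (P s) t \<bullet> D (P s) t)" for t
  define e' where "e' t = integral unit_cell (\<lambda>s. 2 * (D (P s) t \<bullet> R (P s) t))" for t
  have P_cont: "continuous_on X (\<lambda>z. P (f z))" if "continuous_on X f" for X :: "'z::topological_space set" and f
    unfolding P_def by (intro continuous_intros that)
  have D_ode: "((\<lambda>s. D y s) has_vector_derivative R y t) (at t within T)" if "t \<in> T" for y t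
    using ode[OF that, of y] partial_derivative_space_time(2)[OF D'[OF that] that]
    by (simp add: R_def)
  have e_deriv: "(e has_real_derivative e' t) (at t within T)" if t: "t \<in> T" for t
  proof -
    have "((\<lambda>t. integral unit_cell (\<lambda>s. D (P s) t \<bullet> D (P s) t)) has_vector_derivative
        integral unit_cell (\<lambda>s. 2 * (D (P s) t \<bullet> R (P s) t))) (at t within T)"
    proof (rule leibniz_rule_vector_derivative[where fx = "\<lambda>t s. 2 * (D (P s) t \<bullet> R (P s) t)"])
      fix t s assume "t \<in> T"
      from bounded_bilinear.has_vector_derivative[OF bounded_bilinear_inner D_ode[OF this] D_ode[OF this], of "P s" "P s"]
      show "((\<lambda>t. D (P s) t \<bullet> D (P s) t) has_vector_derivative 2 * (D (P s) t \<bullet> R (P s) t)) (at t within T)"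
        by (simp add: inner_commute)
    next
      fix t assume "t \<in> T"
      then show "(\<lambda>s. D (P s) t \<bullet> D (P s) t) integrable_on unit_cell"
        by (intro integrable_continuous continuous_intros cont_D P_cont) auto
    next
      show "continuous_on (T \<times> unit_cell) (\<lambda>(t, s). 2 * (D (P s) t \<bullet> R (P s) t))"
        unfolding R_def case_prod_beta
        by (intro continuous_intros cont_D cont_D' P_cont A.continuous_on L.continuous_on) auto
    qed (use t T in \<open>auto simp: is_interval_convex\<close>)
    then show ?thesis
      by (simp add: e_def[abs_def] e'_def has_real_derivative_iff_has_vector_derivative)
  qed
  obtain K where K: "\<And>z. norm (L z) \<le> norm z * K"
    using L.bounded by auto
  have e_bound: "\<bar>e' t\<bar> \<le> 2 * K * e t" if t: "t \<in> T" for t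
  proof -
    have flux: "integral unit_cell (\<lambda>s. 2 * (D (P s) t \<bullet> A j (D' (P s, t) (axis j 1, 0)))) = 0" for j
      unfolding P_def
    proof (rule integral_periodic_derivative_cell[OF p, where \<phi> = "\<lambda>y. D y t \<bullet> A j (D y t)"
          and \<phi>' = "\<lambda>y h. 2 * (D y t \<bullet> A j (D' (y, t) (h, 0)))"])
      fix y
      note d = partial_derivative_space_time(1)[OF D'[OF t] t, of y]
      show "((\<lambda>y. D y t \<bullet> A j (D y t)) has_derivative (\<lambda>h. 2 * (D y t \<bullet> A j (D' (y, t) (h, 0))))) (at y)"
        by (rule has_derivative_eq_rhs[OF has_derivative_inner[OF d A.has_derivative[OF d]]])
          (simp add: fun_eq_iff A(2) inner_commute)
    next
      show "periodic p (\<lambda>y. D y t \<bullet> A j (D y t))"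
        using per[OF t] by (simp add: periodic_def)
    next
      fix h
      show "continuous_on UNIV (\<lambda>y. 2 * (D y t \<bullet> A j (D' (y, t) (h, 0))))"
        using t by (intro continuous_intros cont_D cont_D' A.continuous_on) auto
    qed
    have int_L: "(\<lambda>s. 2 * (D (P s) t \<bullet> L (D (P s) t))) integrable_on unit_cell"
      using t by (intro integrable_continuous continuous_intros cont_D P_cont L.continuous_on) auto
    have int_A: "(\<lambda>s. 2 * (D (P s) t \<bullet> A j (D' (P s, t) (axis j 1, 0)))) integrable_on unit_cell" for j
      using t by (intro integrable_continuous continuous_intros cont_D cont_D' P_cont A.continuous_on) auto
    have "e' t = integral unit_cell (\<lambda>s. 2 * (D (P s) t \<bullet> L (D (P s) t)) +
        (\<Sum>j\<in>UNIV. 2 * (D (P s) t \<bullet> A j (D' (P s, t) (axis j 1, 0)))))"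
      by (simp add: e'_def R_def inner_add_right inner_sum_right sum_distrib_left algebra_simps)
    also have "\<dots> = integral unit_cell (\<lambda>s. 2 * (D (P s) t \<bullet> L (D (P s) t))) +
       (\<Sum>j\<in>UNIV. integral unit_cell (\<lambda>s. 2 * (D (P s) t \<bullet> A j (D' (P s, t) (axis j 1, 0)))))"
      by (simp only: integral_add[OF int_L integrable_sum[OF finite int_A]] integral_sum[OF finite int_A])
    also have "\<dots> = integral unit_cell (\<lambda>s. 2 * (D (P s) t \<bullet> L (D (P s) t)))"
      by (simp only: flux sum.neutral_const add_0_right)
    finally have "\<bar>e' t\<bar> = norm (integral unit_cell (\<lambda>s. 2 * (D (P s) t \<bullet> L (D (P s) t))))"
      by simp
    also have "\<dots> \<le> integral unit_cell (\<lambda>s. 2 * K * (D (P s) t \<bullet> D (P s) t))"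
    proof (rule integral_norm_bound_integral)
      fix s
      have "\<bar>D (P s) t \<bullet> L (D (P s) t)\<bar> \<le> norm (D (P s) t) * (norm (D (P s) t) * K)"
        using Cauchy_Schwarz_ineq2 K by (meson mult_left_mono norm_ge_zero order_trans)
      then show "norm (2 * (D (P s) t \<bullet> L (D (P s) t))) \<le> 2 * K * (D (P s) t \<bullet> D (P s) t)"
        by (simp add: abs_mult dot_square_norm power2_eq_square mult_ac)
    next
      show "(\<lambda>s. 2 * K * (D (P s) t \<bullet> D (P s) t)) integrable_on unit_cell"
        using t by (intro integrable_continuous continuous_intros cont_D P_cont) auto
    qed (rule int_L)
    also have "\<dots> = 2 * K * e t"
      by (simp add: e_def)
    finally show ?thesis .
  qed
  have "e t \<le> e 0 * exp (2 * K * \<bar>t\<bar>)"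
    using exp_growth_bound[OF T t e_deriv e_bound] .
  also have "e 0 = 0"
    by (simp add: e_def init)
  finally have "e t \<le> 0" by simp
  moreover have "0 \<le> e t"
    unfolding e_def by (rule integral_nonneg)
      (use t in \<open>auto intro!: integrable_continuous continuous_intros cont_D P_cont\<close>)
  ultimately have "e t = 0" by simp
  have c: "continuous_on unit_cell (\<lambda>s. D (P s) t \<bullet> D (P s) t)"
    using t by (intro continuous_intros cont_D P_cont) auto
  have "((\<lambda>s. D (P s) t \<bullet> D (P s) t) has_integral 0) unit_cell"
    using integrable_integral[OF integrable_continuous[OF c]] \<open>e t = 0\<close> by (simp add: e_def)
  from has_integral_0_cbox_imp_0[OF c _ this, of "(0, 0, 0)"]
  have "D (P (0, 0, 0)) t \<bullet> D (P (0, 0, 0)) t = 0"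
    by (auto simp: box_ne_empty Basis_prod_def cbox_Pair_eq)
  then show ?thesis
    by (simp add: P_def cell_point_def)
qed

section \<open>Linear algebra of field vectors\<close>

lemma upper_nth [simp]: "upper z $ d = z $ Inl d" and lower_nth [simp]: "lower z $ d = z $ Inr d"
  by (simp_all add: upper_def lower_def)

lemma blk_nth [simp]: "blk U W $ Inl d = U $ d" "blk U W $ Inr d = W $ d"
  by (simp_all add: blk_def)

lemma upper_blk [simp]: "upper (blk U W) = U" and lower_blk [simp]: "lower (blk U W) = W"
  by (simp_all add: vec_eq_iff)

lemma C6_eq_iff: "z = z' \<longleftrightarrow> upper z = upper z' \<and> lower z = lower z'"
  by (auto simp: vec_eq_iff split_sum_all)

lemma inner_C6: "z \<bullet> z' = upper z \<bullet> upper z' + lower z \<bullet> lower z'" for z z' :: C6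
  by (simp add: inner_vec_def UNIV_Plus_UNIV[symmetric] sum.Plus del: UNIV_Plus_UNIV)

lemma
  shows upper_add [simp]: "upper (z + z') = upper z + upper z'"
    and lower_add [simp]: "lower (z + z') = lower z + lower z'"
    and upper_smult [simp]: "upper (c *s z) = c *s upper z"
    and lower_smult [simp]: "lower (c *s z) = c *s lower z"
    and upper_scaleR [simp]: "upper (r *\<^sub>R z) = r *\<^sub>R upper z"
    and lower_scaleR [simp]: "lower (r *\<^sub>R z) = r *\<^sub>R lower z"
  by (simp_all add: vec_eq_iff)

lemma bounded_linear_upper: "bounded_linear upper" and bounded_linear_lower: "bounded_linear lower"
  by (simp_all add: linear_conv_bounded_linear[symmetric] linear_iff)

lemma upper_sum [simp]: "upper (\<Sum>i\<in>A. f i) = (\<Sum>i\<in>A. upper (f i))"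
  and lower_sum [simp]: "lower (\<Sum>i\<in>A. f i) = (\<Sum>i\<in>A. lower (f i))"
  by (simp_all add: linear_sum bounded_linear.linear bounded_linear_upper bounded_linear_lower)

lemma bounded_linear_re_vec: "bounded_linear (re_vec :: complex^'n \<Rightarrow> real^'n)"
  by (simp add: linear_conv_bounded_linear[symmetric] linear_iff re_vec_def vec_eq_iff)

lemma norm_smult [simp]: "norm (c *s z) = cmod c * norm z" for z :: "complex^'n"
  by (simp add: norm_vec_def norm_mult L2_set_right_distrib)

lemma norm_blk: "norm (blk U W) \<le> norm U + norm W"
proof -
  have "(norm (blk U W))\<^sup>2 = (norm U)\<^sup>2 + (norm W)\<^sup>2"
    unfolding power2_norm_eq_inner inner_C6 by simp
  also have "\<dots> \<le> (norm U + norm W)\<^sup>2"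
    by (simp add: power2_sum)
  finally show ?thesis
    by (rule power2_le_imp_le) simp
qed

lemma bounded_bilinear_smult: "bounded_bilinear ((*s) :: complex \<Rightarrow> complex^'n \<Rightarrow> complex^'n)"
proof
  show "\<exists>K. \<forall>c (z :: complex^'n). norm (c *s z) \<le> norm c * norm z * K"
    by (intro exI[of _ 1]) simp
qed (simp_all add: vec_eq_iff algebra_simps)

subsection \<open>Curl as a symmetric first-order operator\<close>

text \<open>
  The cross product of a real and a complex vector; \<open>flux w\<close> below is the symbol of the curl part of
  the system, so that on $e^{i x \cdot w}$ the curl part acts as \<open>i flux w\<close>.
\<close>

definition cross_c :: "real^3 \<Rightarrow> complex^3 \<Rightarrow> complex^3" where
  "cross_c w u = vector [complex_of_real (w $ 2) * u $ 3 - complex_of_real (w $ 3) * u $ 2,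
     complex_of_real (w $ 3) * u $ 1 - complex_of_real (w $ 1) * u $ 3, complex_of_real (w $ 1) * u $ 2 - complex_of_real (w $ 2) * u $ 1]"

definition flux :: "real^3 \<Rightarrow> C6 \<Rightarrow> C6" where
  "flux w z = blk (cross_c w (lower z)) (- cross_c w (upper z))"

definition damping :: "real^3^3 \<Rightarrow> C6 \<Rightarrow> C6" where
  "damping S z = blk (- (cmat S *v upper z)) 0"

lemma cross_c_nth [simp]:
  "cross_c w u $ 1 = complex_of_real (w $ 2) * u $ 3 - complex_of_real (w $ 3) * u $ 2"
  "cross_c w u $ 2 = complex_of_real (w $ 3) * u $ 1 - complex_of_real (w $ 1) * u $ 3"
  "cross_c w u $ 3 = complex_of_real (w $ 1) * u $ 2 - complex_of_real (w $ 2) * u $ 1"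
  by (simp_all add: cross_c_def)

lemma bounded_bilinear_cross_c: "bounded_bilinear cross_c"
  unfolding bilinear_conv_bounded_bilinear[symmetric] bilinear_def linear_iff
  by (simp add: vec_eq_iff forall_3) (simp add: scaleR_conv_of_real algebra_simps)

interpretation cross_c: bounded_bilinear cross_c
  by (rule bounded_bilinear_cross_c)

lemma cross_c_smult: "cross_c w (c *s u) = c *s cross_c w u"
  by (simp add: vec_eq_iff forall_3 algebra_simps)

lemma inner_cross_c: "u \<bullet> cross_c w u' = - (cross_c w u \<bullet> u')"
  by (simp add: inner_vec_def sum_3 inner_complex_def algebra_simps)

lemma bounded_bilinear_flux: "bounded_bilinear flux"
  unfolding bilinear_conv_bounded_bilinear[symmetric] bilinear_def linear_iff
  by (auto simp: flux_def C6_eq_iff cross_c.add_left cross_c.add_right cross_c.scaleR_left cross_c.scaleR_right)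

interpretation flux: bounded_bilinear flux
  by (rule bounded_bilinear_flux)

lemma flux_smult: "flux w (c *s z) = c *s flux w z"
  by (simp add: flux_def C6_eq_iff cross_c_smult)

text \<open>
  The cross product with \<open>w\<close> is antisymmetric, and so is the sign pattern of the two blocks.
\<close>

lemma flux_symmetric: "y \<bullet> flux w z = flux w y \<bullet> z"
  by (simp add: flux_def inner_C6 inner_cross_c)

lemma bounded_linear_damping: "bounded_linear (damping S)"
proof -
  have "linear (damping S)"
    by (simp add: linear_iff damping_def C6_eq_iff matrix_vector_right_distrib)
      (simp add: vec_eq_iff matrix_vector_mult_def scaleR_sum_right)
  then show ?thesis
    by (simp add: linear_conv_bounded_linear)
qed

lemma damping_smult: "damping S (c *s z) = c *s damping S z"
  by (simp add: damping_def C6_eq_iff) (simp add: vec_eq_iff matrix_vector_mult_def sum_distrib_left mult_ac)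

lemma pd_bounded_linear:
  assumes "bounded_linear L" "F differentiable (at x)"
  shows "pd j (\<lambda>y. L (F y)) x = L (pd j F x)"
proof -
  have "((\<lambda>y. L (F y)) has_derivative (\<lambda>h. L (frechet_derivative F (at x) h))) (at x)"
    using assms bounded_linear.has_derivative frechet_derivative_works by blast
  then show ?thesis
    unfolding pd_def using frechet_derivative_at by metis
qed

lemma curl_eq_cross: "curl F x = (\<Sum>j\<in>UNIV. cross_c (axis j 1) (pd j F x))"
  by (simp add: vec_eq_iff forall_3 curl_def sum_3 axis_def)

lemma maxwell_op_eq:
  assumes "Z differentiable (at x)"
  shows "maxwell_op S Z x = damping S (Z x) + (\<Sum>j\<in>UNIV. flux (axis j 1) (pd j Z x))"
  by (simp add: maxwell_op_def C6_eq_iff damping_def flux_def curl_eq_cross sum_negf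
      pd_bounded_linear[OF bounded_linear_upper assms] pd_bounded_linear[OF bounded_linear_lower assms])

section \<open>The curl eigenvectors\<close>

lemma norm_sq_3: "(norm w)\<^sup>2 = (w $ 1)\<^sup>2 + (w $ 2)\<^sup>2 + (w $ 3)\<^sup>2" for w :: "real^3"
  unfolding power2_norm_eq_inner inner_vec_def by (simp add: sum_3 power2_eq_square)

lemma norm_r_of_sq: "(norm (r_of w))\<^sup>2 = 3 * (norm w)\<^sup>2 - (s_of w)\<^sup>2"
  unfolding norm_sq_3 by (simp add: r_of_def s_of_def power2_eq_square algebra_simps)

lemma cvec_nth [simp]: "cvec x $ i = of_real (x $ i)"
  by (simp add: cvec_def)

lemma v_generic:
  assumes "d \<noteq> 1" "r_of w \<noteq> 0"
  shows "v d w = complex_of_real (1 / nu w) *s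
          (cvec ((s_of w / (norm w)\<^sup>2) *\<^sub>R w) - vector [1, 1, 1]
             - (\<i> * complex_of_real (mu d w / (norm w)\<^sup>2)) *s cvec (r_of w))"
  using assms by (simp add: v_def)

lemma r_of_eq_0: "r_of w = 0 \<longleftrightarrow> w $ 2 = w $ 1 \<and> w $ 3 = w $ 1"
  by (auto simp: r_of_def vec_eq_iff forall_3)

text \<open>
  Both signs of \<open>w $ 1\<close> and both indices \<open>d\<close> lead to the same vector up to the choice of a square
  root \<open>\<sigma>\<close> of 3, which also carries the sign of the eigenvalue.
\<close>

lemma v_diagonal:
  assumes "d \<noteq> 1" "r_of w = 0" "w \<noteq> 0"
  obtains \<sigma> where "\<sigma>\<^sup>2 = 3" "mu d w = - \<sigma> * w $ 1"
    "v d w = complex_of_real (1 / sqrt 3) *s vector [Complex (1/2) (\<sigma>/2), Complex (1/2) (-\<sigma>/2), -1]"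
proof -
  define \<sigma> where "\<sigma> = (if (d = 2) = (w $ 1 \<ge> 0) then sqrt 3 else - sqrt 3)"
  have "(norm w)\<^sup>2 = (sqrt 3 * \<bar>w $ 1\<bar>)\<^sup>2"
    using assms(2) unfolding norm_sq_3 r_of_eq_0 by (simp add: power_mult_distrib)
  then have "norm w = sqrt 3 * \<bar>w $ 1\<bar>"
    by (simp add: power2_eq_iff_nonneg)
  then show thesis
    using assms
    by (intro that[of \<sigma>])
       (auto simp: \<sigma>_def mu_def v_def v2_diag_def cnj_vec_def Let_def vec_eq_iff forall_3 complex_eq_iff)
qed

text \<open>
  In the generic case, with \<open>\<one> = (1, 1, 1)\<close> and \<open>r\<close>, \<open>s\<close> for \<open>r_of w\<close>, \<open>s_of w\<close>, the cross product
  with \<open>w\<close> sends \<open>w\<close> to 0, \<open>\<one>\<close> to \<open>r\<close>, and \<open>r\<close> to \<open>s w - |w|\<^sup>2 \<one>\<close>.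
\<close>

lemma cross_c_v:
  assumes "w \<noteq> 0"
  shows "\<i> *s cross_c w (v d w) = complex_of_real (mu d w) *s v d w"
proof (cases "d = 1")
  case True
  then show ?thesis
    by (simp add: v_def mu_def vec_eq_iff forall_3)
next
  case d: False
  show ?thesis
  proof (cases "r_of w = 0")
    case True
    obtain \<sigma> where \<sigma>: "\<sigma>\<^sup>2 = 3" "mu d w = - \<sigma> * w $ 1"
      "v d w = complex_of_real (1 / sqrt 3) *s vector [Complex (1/2) (\<sigma>/2), Complex (1/2) (-\<sigma>/2), -1]"
      using v_diagonal[OF d True assms] .
    show ?thesis
      unfolding \<sigma>(2,3) using True[unfolded r_of_eq_0] \<sigma>(1)
      by (simp add: vec_eq_iff forall_3 complex_eq_iff field_simps power2_eq_square)
  next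
    case False
    define m where "m = mu d w"
    have m: "(norm w)\<^sup>2 = m\<^sup>2" "m \<noteq> 0"
      using assms d by (auto simp: m_def mu_def)
    let ?one = "vector [1, 1, 1] :: complex^3"
    have 1: "cross_c w (cvec (c *\<^sub>R w)) = 0" for c
      by (simp add: vec_eq_iff forall_3)
    have 2: "cross_c w ?one = cvec (r_of w)"
      by (simp add: vec_eq_iff forall_3 r_of_def)
    have 3: "cross_c w (cvec (r_of w)) = cvec (s_of w *\<^sub>R w) - complex_of_real (m\<^sup>2) *s ?one"
      unfolding m(1)[symmetric] norm_sq_3
      by (simp add: vec_eq_iff forall_3 r_of_def s_of_def power2_eq_square algebra_simps)
    let ?u = "cvec ((s_of w / m\<^sup>2) *\<^sub>R w) - ?one - (\<i> * complex_of_real (m / m\<^sup>2)) *s cvec (r_of w)"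
    have "\<i> *s cross_c w ?u = complex_of_real m *s ?u"
      unfolding cross_c.diff_right cross_c_smult 1 2 3 using m(2)
      by (simp add: vec_eq_iff forall_3 field_simps power2_eq_square)
    then have "\<i> *s cross_c w (c *s ?u) = complex_of_real m *s (c *s ?u)" for c
      by (simp only: cross_c_smult vec.scale_left_commute[of _ c])
    then show ?thesis
      unfolding v_generic[OF d False] m_def[symmetric] m(1) .
  qed
qed

lemma norm_cvec [simp]: "norm (cvec x) = norm x"
  by (simp add: norm_vec_def)

lemma norm_v:
  assumes "w \<noteq> 0"
  shows "norm (v d w) = 1"
proof (cases "d = 1")
  case True
  then show ?thesis
    using assms by (simp only: v_def if_True norm_cvec) simp
next
  case d: False
  have "(norm (v d w))\<^sup>2 = 1"
  proof (cases "r_of w = 0")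
    case True
    obtain \<sigma> where \<sigma>: "\<sigma>\<^sup>2 = 3" "mu d w = - \<sigma> * w $ 1"
      "v d w = complex_of_real (1 / sqrt 3) *s vector [Complex (1/2) (\<sigma>/2), Complex (1/2) (-\<sigma>/2), -1]"
      using v_diagonal[OF d True assms] .
    show ?thesis
      unfolding \<sigma>(3) using \<sigma>(1)
      by (simp add: power_mult_distrib power_divide)
        (simp only: power2_norm_eq_inner inner_vec_def, simp add: sum_3 inner_complex_def power2_eq_square field_simps)
  next
    case False
    define m where "m = mu d w"
    have m: "(norm w)\<^sup>2 = m\<^sup>2" "m \<noteq> 0"
      using assms d by (auto simp: m_def mu_def)
    let ?u = "cvec ((s_of w / m\<^sup>2) *\<^sub>R w) - vector [1, 1, 1] - (\<i> * complex_of_real (m / m\<^sup>2)) *s cvec (r_of w)"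
    have "(norm ?u)\<^sup>2 = (\<Sum>j\<in>UNIV. (s_of w / m\<^sup>2 * w $ j - 1)\<^sup>2 + (r_of w $ j / m)\<^sup>2)"
      unfolding power2_norm_eq_inner inner_vec_def using m(2)
      by (simp add: sum_3 inner_complex_def power2_eq_square)
    also have "\<dots> = (s_of w / m\<^sup>2)\<^sup>2 * (norm w)\<^sup>2 - 2 * (s_of w / m\<^sup>2) * s_of w + 3 + (norm (r_of w))\<^sup>2 / m\<^sup>2"
      unfolding norm_sq_3 by (simp add: sum_3 s_of_def power2_eq_square algebra_simps add_divide_distrib)
    also have "\<dots> = (nu w)\<^sup>2"
      using m(2) by (simp add: nu_def m(1) norm_r_of_sq power_mult_distrib power_divide)
        (simp add: field_simps power2_eq_square power4_eq_xxxx)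
    finally have "norm ?u = nu w"
      by (simp add: nu_def)
    moreover have "nu w > 0"
      using False assms by (simp add: nu_def)
    ultimately show ?thesis
      unfolding v_generic[OF d False] m_def[symmetric] m(1) norm_smult by (simp add: norm_divide)
  qed
  then show ?thesis
    using power2_eq_imp_eq[of "norm (v d w)" 1] by simp
qed

text \<open>
  The map \<open>u \<mapsto> i w \<times> u\<close> is Hermitian, so its eigenvectors for the distinct eigenvalues \<open>mu d w\<close>
  are orthogonal.
\<close>

lemma v_orthonormal:
  assumes "w \<noteq> 0"
  shows "(\<Sum>i\<in>UNIV. cnj (v d w $ i) * v k w $ i) = (if d = k then 1 else 0)"
proof (cases "d = k")
  case True
  have "(\<Sum>i\<in>UNIV. cnj (v d w $ i) * v d w $ i) = complex_of_real ((norm (v d w))\<^sup>2)"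
    unfolding power2_norm_eq_inner inner_vec_def
    by (simp add: complex_eq_iff inner_complex_def power2_eq_square)
  then show ?thesis
    using True norm_v[OF assms] by simp
next
  case False
  have "cnj (complex_of_real (mu d w) * v d w $ i) = cnj (\<i> * cross_c w (v d w) $ i)"
    and "complex_of_real (mu k w) * v k w $ i = \<i> * cross_c w (v k w) $ i" for i
    using arg_cong[OF cross_c_v[OF assms], of "\<lambda>z. z $ i"] by simp_all
  then have "(\<Sum>i\<in>UNIV. cnj (complex_of_real (mu d w) * v d w $ i) * v k w $ i) =
    (\<Sum>i\<in>UNIV. cnj (v d w $ i) * (complex_of_real (mu k w) * v k w $ i))"
    by (simp only:) (simp add: sum_3 algebra_simps)
  then have "complex_of_real (mu d w) * (\<Sum>i\<in>UNIV. cnj (v d w $ i) * v k w $ i) =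
    complex_of_real (mu k w) * (\<Sum>i\<in>UNIV. cnj (v d w $ i) * v k w $ i)"
    by (simp add: sum_distrib_left mult_ac)
  moreover have "mu d w \<noteq> mu k w"
    using False assms exhaust_3[of d] exhaust_3[of k] by (auto simp: mu_def)
  ultimately show ?thesis
    using False by simp
qed

lemma Vmat_unitary:
  assumes "w \<noteq> 0"
  shows "dagger (Vmat w) ** Vmat w = mat 1" "Vmat w ** dagger (Vmat w) = mat 1"
proof -
  show "dagger (Vmat w) ** Vmat w = mat 1"
    using v_orthonormal[OF assms]
    by (simp add: dagger_def Vmat_def matrix_matrix_mult_def transpose_def map_matrix_def mat_def)
  then show "Vmat w ** dagger (Vmat w) = mat 1"
    by (rule matrix_left_right_inverse[THEN iffD1])
qed

lemma Vmat_mult: "Vmat w *v a = (\<Sum>d\<in>UNIV. a $ d *s v d w)"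
  by (simp add: Vmat_def matrix_vector_mult_def vec_eq_iff mult.commute)

lemma Vmat_inject: "w \<noteq> 0 \<Longrightarrow> Vmat w *v a = Vmat w *v b \<longleftrightarrow> a = b"
  by (metis Vmat_unitary(1) matrix_vector_mul_assoc matrix_vector_mul_lid)

lemma cross_c_Vmat:
  assumes "w \<noteq> 0"
  shows "\<i> *s cross_c w (Vmat w *v a) = Vmat w *v (\<chi> d. complex_of_real (mu d w) * a $ d)"
proof -
  have "\<i> *s cross_c w (Vmat w *v a) = (\<Sum>d\<in>UNIV. a $ d *s (\<i> *s cross_c w (v d w)))"
    unfolding Vmat_mult cross_c.sum_right cross_c_smult vec.scale_sum_right
    by (intro sum.cong refl vec.scale_left_commute)
  also have "\<dots> = Vmat w *v (\<chi> d. complex_of_real (mu d w) * a $ d)"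
    unfolding cross_c_v[OF assms] Vmat_mult by (simp add: mult.commute)
  finally show ?thesis .
qed

section \<open>Plane wave modes\<close>

definition from_basis :: "real^3 \<Rightarrow> C6 \<Rightarrow> C6" where
  "from_basis w h = blk (Vmat w *v upper h) (Vmat w *v lower h)"

text \<open>
  Applying \<open>Vmat w\<close> to the coefficient equations turns multiplication by \<open>mu d w\<close> into the symbol of
  curl and, since \<open>V V\<^sup>\<dagger> = 1\<close>, turns \<open>Mmat S w\<close> back into \<open>S\<close>.
\<close>

lemma eigen_amplitude:
  assumes "w \<noteq> 0" "eigen_eqs S w l h"
  shows "(\<i> * l) *s from_basis w h = damping S (from_basis w h) + \<i> *s flux w (from_basis w h)"
proof -
  define a where "a = upper h"
  define b where "b = lower h"
  define M where "M = Mmat S w"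
  define m where "m = (\<lambda>c::complex^3. \<chi> d. complex_of_real (mu d w) * c $ d)"
  have lb: "l * b $ d = \<i> * a $ d * complex_of_real (mu d w)"
    and la: "l * a $ d = - \<i> * b $ d * complex_of_real (mu d w) + \<i> * (\<Sum>j\<in>UNIV. a $ j * M $ d $ j)" for d
    using assms(2) by (auto simp: eigen_eqs_def Let_def a_def b_def M_def)
  have "(\<i> * l) *s a = m b - M *v a"
    by (simp add: vec_eq_iff mult.assoc la m_def matrix_vector_mult_def algebra_simps)
  then have "(\<i> * l) *s (Vmat w *v a) = Vmat w *v m b - Vmat w *v (M *v a)"
    by (metis matrix_vector_mult_diff_distrib vector_scalar_commute)
  also have "Vmat w *v (M *v a) = cmat S *v (Vmat w *v a)"
    unfolding M_def Mmat_def matrix_vector_mul_assoc matrix_mul_assoc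
    by (simp add: Vmat_unitary(2)[OF assms(1)])
  also have "Vmat w *v m b = \<i> *s cross_c w (Vmat w *v b)"
    by (simp add: cross_c_Vmat[OF assms(1)] m_def)
  finally have up: "(\<i> * l) *s (Vmat w *v a) = \<i> *s cross_c w (Vmat w *v b) - cmat S *v (Vmat w *v a)" .
  have "(\<i> * l) *s b = - m a"
    by (simp add: vec_eq_iff mult.assoc lb m_def)
  then have "(\<i> * l) *s (Vmat w *v b) = - (Vmat w *v m a)"
    by (metis vector_scalar_commute vec.neg)
  also have "Vmat w *v m a = \<i> *s cross_c w (Vmat w *v a)"
    by (simp add: cross_c_Vmat[OF assms(1)] m_def)
  finally have low: "(\<i> * l) *s (Vmat w *v b) = - (\<i> *s cross_c w (Vmat w *v a))" .
  show ?thesis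
    unfolding C6_eq_iff from_basis_def a_def[symmetric] b_def[symmetric]
    by (simp add: up low damping_def flux_def)
qed

text \<open>
  The value of \<open>wave_mode\<close> at \<open>x = 0\<close>; the dependence on \<open>x\<close> is a factor of modulus one.
\<close>

definition amplitude :: "real^3 \<Rightarrow> (6 \<Rightarrow> complex) \<Rightarrow> (6 \<Rightarrow> C6) \<Rightarrow> (6 \<Rightarrow> complex) \<Rightarrow> real \<Rightarrow> C6" where
  "amplitude w lam h c t =
     (\<Sum>k\<in>UNIV. (c k * exp (\<i> * lam k * complex_of_real t)) *s from_basis w (h k))"

lemma wave_mode_eq:
  "wave_mode w lam h c x t = exp (\<i> * complex_of_real (x \<bullet> w)) *s amplitude w lam h c t"
  by (simp add: wave_mode_def eigen_wave_def plane_wave_def amplitude_def from_basis_def Vmat_mult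
      vec.scale_sum_right mult_ac)

lemma amplitude_ode:
  fixes c :: "6 \<Rightarrow> complex"
  assumes "w \<noteq> 0" "\<And>k. eigen_eqs S w (lam k) (h k)"
  defines "z \<equiv> amplitude w lam h c"
  shows "(z has_vector_derivative (damping S (z t) + \<i> *s flux w (z t))) (at t within T)"
proof -
  note bl = bounded_bilinear.bounded_linear_left[OF bounded_bilinear_smult]
  have exp: "((\<lambda>t. c k * exp (\<i> * lam k * complex_of_real t)) has_vector_derivative
      c k * exp (\<i> * lam k * complex_of_real t) * (\<i> * lam k)) (at t within T)" for k
    by (rule has_vector_derivative_real_field) (auto intro!: derivative_eq_intros)
  have "(z has_vector_derivative
     (\<Sum>k\<in>UNIV. (c k * exp (\<i> * lam k * complex_of_real t) * (\<i> * lam k)) *s from_basis w (h k))) (at t within T)"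
    unfolding z_def amplitude_def[abs_def]
    by (intro has_vector_derivative_sum bounded_linear.has_vector_derivative[OF bl] exp)
  also have "(\<Sum>k\<in>UNIV. (c k * exp (\<i> * lam k * complex_of_real t) * (\<i> * lam k)) *s from_basis w (h k)) =
      damping S (z t) + \<i> *s flux w (z t)"
  proof -
    have "(b * (\<i> * lam k)) *s from_basis w (h k) =
        b *s damping S (from_basis w (h k)) + (\<i> * b) *s flux w (from_basis w (h k))" for b k
    proof -
      have "(b * (\<i> * lam k)) *s from_basis w (h k) = b *s ((\<i> * lam k) *s from_basis w (h k))"
        by (rule vector_smult_assoc[symmetric])
      then show ?thesis
        unfolding eigen_amplitude[OF assms(1,2)] by (simp add: vec.scale_right_distrib mult.commute)
    qed
    then show ?thesis
      unfolding z_def amplitude_def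
      by (simp add: linear_sum[OF bounded_linear.linear[OF bounded_linear_damping]] flux.sum_right
          damping_smult flux_smult vec.scale_sum_right sum.distrib)
  qed
  finally show ?thesis .
qed

text \<open>
  \<open>flux w\<close> is symmetric and commutes with \<open>i\<close>, which is antisymmetric; so \<open>i flux w\<close> is antisymmetric.
\<close>

lemma inner_i_flux: "z \<bullet> (\<i> *s flux w z) = 0"
proof -
  have adj: "u \<bullet> (\<i> *s u') = - ((\<i> *s u) \<bullet> u')" for u u' :: C6
    by (simp add: inner_vec_def inner_complex_def sum_negf[symmetric])
  have "z \<bullet> (\<i> *s flux w z) = - (z \<bullet> flux w (\<i> *s z))"
    by (metis adj flux_symmetric inner_commute)
  then show ?thesis
    by (simp add: flux_smult)
qed

text \<open>
  The growth rate \<open>K\<close> is the same for all wave vectors and all exponents \<open>lam\<close>, because the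
  oscillating part \<open>i flux w\<close> does no work.
\<close>

lemma amplitude_bound:
  assumes "w \<noteq> 0" "\<And>k. eigen_eqs S w (lam k) (h k)"
    and K: "\<And>z. norm (damping S z) \<le> norm z * K"
  shows "norm (amplitude w lam h c t) \<le> norm (amplitude w lam h c 0) * exp (K * \<bar>t\<bar>)"
proof -
  define z where "z = amplitude w lam h c"
  define e where "e t = z t \<bullet> z t" for t
  have "e t \<le> e 0 * exp (2 * K * \<bar>t\<bar>)"
  proof (rule exp_growth_bound[of UNIV])
    fix s :: real
    note d = amplitude_ode[where lam = lam and h = h, OF assms(1,2), where c = c and T = UNIV and t = s, folded z_def]
    have "(e has_vector_derivative 2 * (z s \<bullet> damping S (z s))) (at s)"
      using bounded_bilinear.has_vector_derivative[OF bounded_bilinear_inner d d]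
      by (simp add: e_def[abs_def] inner_add inner_i_flux inner_commute)
    then show "(e has_real_derivative 2 * (z s \<bullet> damping S (z s))) (at s)"
      by (simp add: has_real_derivative_iff_has_vector_derivative)
    have "\<bar>z s \<bullet> damping S (z s)\<bar> \<le> norm (z s) * (norm (z s) * K)"
      using Cauchy_Schwarz_ineq2 K by (meson mult_left_mono norm_ge_zero order_trans)
    then show "\<bar>2 * (z s \<bullet> damping S (z s))\<bar> \<le> 2 * K * e s"
      by (simp add: e_def abs_mult dot_square_norm power2_eq_square mult_ac)
  qed auto
  then have "(norm (z t))\<^sup>2 \<le> (norm (z 0) * exp (K * \<bar>t\<bar>))\<^sup>2"
    by (simp add: e_def dot_square_norm power_mult_distrib exp_double[symmetric] mult_ac)
  then show ?thesis
    unfolding z_def by (rule power2_le_imp_le) simp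
qed

section \<open>Coefficients of the initial data\<close>

lemma basis_coefficients:
  fixes h :: "6 \<Rightarrow> C6"
  assumes "inj h" "vec.independent (range h)"
  shows "\<exists>!c. (\<Sum>k\<in>UNIV. c k *s h k) = z"
proof -
  have "card (range h) = 6"
    using assms(1) by (simp add: card_image)
  then have "UNIV \<subseteq> vec.span (range h)"
    using vec.card_ge_dim_independent[of "range h" UNIV] assms(2) by (simp add: vec_dim_card del: vec.dim_UNIV)
  then have "z \<in> range (\<lambda>u. \<Sum>y\<in>range h. u y *s y)"
    using vec.span_finite[of "range h"] by auto
  then obtain u where "z = (\<Sum>y\<in>range h. u y *s y)"
    by (elim imageE)
  then have z: "(\<Sum>k\<in>UNIV. u (h k) *s h k) = z"
    using sum.reindex[OF assms(1), of "\<lambda>y. u y *s y"] by (simp only: o_def)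
  have "c = (\<lambda>k. u (h k))" if c: "(\<Sum>k\<in>UNIV. c k *s h k) = z" for c
  proof -
    have "(\<Sum>k\<in>UNIV. (c k - u (h k)) *s h k) = 0"
      unfolding vec.scale_left_diff_distrib sum_subtractf c z by simp
    then have "(\<Sum>y\<in>range h. (c (inv h y) - u y) *s y) = 0"
      using sum.reindex[OF assms(1), of "\<lambda>y. (c (inv h y) - u y) *s y"]
      by (simp only: o_def inv_f_f[OF assms(1)])
    then have "c (inv h (h k)) - u (h k) = 0" for k
      by (intro vec.independentD[OF assms(2), of "range h" "\<lambda>y. c (inv h y) - u y" "h k"]) auto
    then show ?thesis
      using assms(1) by (simp add: fun_eq_iff)
  qed
  with z show ?thesis
    by (intro ex1I)
qed

lemma from_basis_inject: "w \<noteq> 0 \<Longrightarrow> from_basis w h = from_basis w h' \<longleftrightarrow> h = h'"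
  by (simp add: from_basis_def C6_eq_iff[of "blk _ _"] C6_eq_iff[of h] Vmat_inject)

lemma from_basis_sum: "from_basis w (\<Sum>k\<in>A. c k *s h k) = (\<Sum>k\<in>A. c k *s from_basis w (h k))"
  by (simp add: from_basis_def C6_eq_iff vec.sum vec.scale)

lemma initial_mode_iff:
  "(\<forall>x. wave_mode w lam h c x 0 = plane_wave w X Y x) \<longleftrightarrow> amplitude w lam h c 0 = blk X Y"
  unfolding wave_mode_eq plane_wave_def by (auto dest: spec[of _ 0])

text \<open>
  \<open>from_basis w\<close> is injective, so the initial condition says that the given coefficient vector is
  expanded in the basis \<open>h\<close>.
\<close>

lemma unique_initial_mode:
  assumes "w \<noteq> 0" "inj h" "vec.independent (range h)"
    and "X = (\<Sum>d\<in>UNIV. a $ d *s v d w)" "Y = (\<Sum>d\<in>UNIV. b $ d *s v d w)"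
  shows "\<exists>!c. \<forall>x. wave_mode w lam h c x 0 = plane_wave w X Y x"
proof -
  have "blk X Y = from_basis w (blk a b)"
    by (simp add: from_basis_def Vmat_mult assms(4,5))
  then have "(\<forall>x. wave_mode w lam h c x 0 = plane_wave w X Y x) \<longleftrightarrow>
      (\<Sum>k\<in>UNIV. c k *s h k) = blk a b" for c
    unfolding initial_mode_iff using from_basis_inject[OF assms(1)]
    by (simp add: amplitude_def from_basis_sum[symmetric])
  then show ?thesis
    using basis_coefficients[OF assms(2,3)] by simp
qed

text \<open>
  A nonzero wave vector has a nonzero inner product with some period, and this product is an integer
  multiple of \<open>2 * pi\<close>. So summability of \<open>|w| N w\<close> gives that of \<open>N w\<close>.
\<close>

lemma wave_vectors_bounded_below:
  assumes "inj p" "independent (range p)" "w \<in> wave_vectors p"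
  shows "1 \<le> (\<Sum>j\<in>UNIV. norm (p j)) * norm w"
proof -
  obtain c where c: "w = (\<Sum>j\<in>UNIV. c j *\<^sub>R p j)"
    using periods_span[OF assms(1,2)] .
  have "\<exists>j. w \<bullet> p j \<noteq> 0"
  proof (rule ccontr)
    assume "\<not> ?thesis"
    then have "w \<bullet> (\<Sum>j\<in>UNIV. c j *\<^sub>R p j) = 0"
      by (simp add: inner_sum_right)
    then show False
      using assms(3) c by (simp add: wave_vectors_def)
  qed
  then obtain j where j: "w \<bullet> p j \<noteq> 0" by blast
  obtain n :: int where n: "w \<bullet> p j = 2 * pi * of_int n"
    using assms(3) unfolding wave_vectors_def by blast
  have "1 \<le> \<bar>of_int n :: real\<bar>"
    using j n by (cases "n = 0") (auto simp flip: of_int_abs)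
  then have "1 \<le> 2 * pi * \<bar>of_int n\<bar>"
    using pi_ge_two mult_mono[of 1 "2 * pi" 1 "\<bar>of_int n :: real\<bar>"] by simp
  also have "\<dots> = \<bar>w \<bullet> p j\<bar>"
    by (simp add: n abs_mult)
  also have "\<dots> \<le> norm (p j) * norm w"
    by (metis Cauchy_Schwarz_ineq2 mult.commute)
  also have "\<dots> \<le> (\<Sum>j\<in>UNIV. norm (p j)) * norm w"
    by (intro mult_right_mono member_le_sum) auto
  finally show ?thesis .
qed

section \<open>Classical solutions\<close>

lemma C1_on_bounded_linear:
  assumes "bounded_linear L" "C1_on f S"
  shows "C1_on (\<lambda>z. L (f z)) S"
proof -
  obtain f' where f': "\<And>z. z \<in> S \<Longrightarrow> (f has_derivative blinfun_apply (f' z)) (at z within S)" "continuous_on S f'"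
    using assms(2) unfolding C1_on_def by blast
  show ?thesis
    unfolding C1_on_def
  proof (intro exI[of _ "\<lambda>z. Blinfun L o\<^sub>L f' z"] conjI ballI)
    show "((\<lambda>z. L (f z)) has_derivative blinfun_apply (Blinfun L o\<^sub>L f' z)) (at z within S)" if "z \<in> S" for z
      by (rule has_derivative_eq_rhs[OF bounded_linear.has_derivative[OF assms(1) f'(1)[OF that]]])
        (simp add: bounded_linear_Blinfun_apply[OF assms(1)] fun_eq_iff)
  qed (intro continuous_intros f'(2))
qed

lemma C1_on_diff:
  assumes "C1_on f S" "C1_on g S"
  shows "C1_on (\<lambda>z. f z - g z) S"
proof -
  obtain f' where f': "\<And>z. z \<in> S \<Longrightarrow> (f has_derivative blinfun_apply (f' z)) (at z within S)" "continuous_on S f'"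
    using assms(1) unfolding C1_on_def by blast
  obtain g' where g': "\<And>z. z \<in> S \<Longrightarrow> (g has_derivative blinfun_apply (g' z)) (at z within S)" "continuous_on S g'"
    using assms(2) unfolding C1_on_def by blast
  show ?thesis
    unfolding C1_on_def
  proof (intro exI[of _ "\<lambda>z. f' z - g' z"] conjI ballI)
    show "((\<lambda>z. f z - g z) has_derivative blinfun_apply (f' z - g' z)) (at z within S)" if "z \<in> S" for z
      by (rule has_derivative_eq_rhs[OF has_derivative_diff[OF f'(1)[OF that] g'(1)[OF that]]])
        (simp add: fun_eq_iff blinfun.diff_left)
  qed (intro continuous_intros f'(2) g'(2))
qed

lemma C1_on_subset:
  assumes "C1_on f S" "S' \<subseteq> S"
  shows "C1_on f S'"
proof -
  obtain f' where f': "\<And>z. z \<in> S \<Longrightarrow> (f has_derivative blinfun_apply (f' z)) (at z within S)" "continuous_on S f'"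
    using assms(1) unfolding C1_on_def by blast
  have "\<forall>z\<in>S'. (f has_derivative blinfun_apply (f' z)) (at z within S')"
    using has_derivative_subset[OF f'(1) assms(2)] assms(2) by blast
  moreover have "continuous_on S' f'"
    using f'(2) assms(2) by (rule continuous_on_subset)
  ultimately show ?thesis
    unfolding C1_on_def by blast
qed

lemma solves_maxwell_subset:
  assumes "solves_maxwell S p T Z0 Z" "T' \<subseteq> T"
  shows "solves_maxwell S p T' Z0 Z"
  unfolding solves_maxwell_def
proof (intro conjI allI ballI)
  show "C1_on (\<lambda>(x, t). Z x t) (UNIV \<times> T')"
    using assms by (intro C1_on_subset[where S' = "UNIV \<times> T'" and S = "UNIV \<times> T"]) (auto simp: solves_maxwell_def)
  show "((\<lambda>s. Z x s) has_vector_derivative maxwell_op S (\<lambda>y. Z y t) x) (at t within T')" if "t \<in> T'" for x t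
    using assms that by (intro has_vector_derivative_within_subset[OF _ assms(2)]) (auto simp: solves_maxwell_def)
qed (use assms in \<open>auto simp: solves_maxwell_def\<close>)

lemma solves_maxwell_differentiable:
  assumes "solves_maxwell S p T Z0 Z" "t \<in> T"
  shows "(\<lambda>y. Z y t) differentiable (at x)"
proof -
  obtain f' where "\<And>z. z \<in> UNIV \<times> T \<Longrightarrow>
      ((\<lambda>(x, t). Z x t) has_derivative blinfun_apply (f' z)) (at z within UNIV \<times> T)"
    using assms(1) unfolding solves_maxwell_def C1_on_def by blast
  then have "((\<lambda>(x, t). Z x t) has_derivative blinfun_apply (f' (x, t))) (at (x, t) within UNIV \<times> T)"
    using assms(2) by simp
  from partial_derivative_space_time(1)[OF this assms(2)] show ?thesis
    by (rule differentiableI)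
qed

lemma pd_diff:
  assumes "f differentiable (at x)" "g differentiable (at x)"
  shows "pd j (\<lambda>y. f y - g y) x = pd j f x - pd j g x"
proof -
  have d: "((\<lambda>y. f y - g y) has_derivative
      (\<lambda>h. frechet_derivative f (at x) h - frechet_derivative g (at x) h)) (at x)"
    using assms by (intro has_derivative_diff) (simp_all add: frechet_derivative_works[symmetric])
  then show ?thesis
    unfolding pd_def by (simp add: frechet_derivative_at[OF d, symmetric])
qed

theorem solves_maxwell_unique:
  assumes p: "inj p" "independent (range p)" and T: "is_interval T" "0 \<in> T"
    and Z: "solves_maxwell S p T Z0 Z" and Z': "solves_maxwell S p T Z0 Z'"
    and t: "t \<in> T"
  shows "Z' x t = Z x t"
proof -
  note d = solves_maxwell_differentiable[OF Z] and d' = solves_maxwell_differentiable[OF Z']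
  interpret damping: bounded_linear "damping S" by (rule bounded_linear_damping)
  have "Z' x t - Z x t = 0"
  proof (rule periodic_symmetric_system_zero[where D = "\<lambda>x t. Z' x t - Z x t"
        and L = "damping S" and A = "\<lambda>j. flux (axis j 1)",
        OF p T bounded_linear_damping flux.bounded_linear_right flux_symmetric])
    show "C1_on (\<lambda>(x, t). Z' x t - Z x t) (UNIV \<times> T)"
      using C1_on_diff[of "\<lambda>(x, t). Z' x t" "UNIV \<times> T" "\<lambda>(x, t). Z x t"] Z Z'
      by (simp add: solves_maxwell_def case_prod_unfold)
    show "periodic p (\<lambda>x. Z' x t - Z x t)" if "t \<in> T" for t
      using Z Z' that by (simp add: solves_maxwell_def periodic_def)
    show "Z' x 0 - Z x 0 = 0" for x
      using Z Z' by (simp add: solves_maxwell_def)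
    fix x t assume t: "t \<in> T"
    have "((\<lambda>s. Z' x s - Z x s) has_vector_derivative
        maxwell_op S (\<lambda>y. Z' y t) x - maxwell_op S (\<lambda>y. Z y t) x) (at t within T)"
      using Z Z' t by (intro has_vector_derivative_diff) (auto simp: solves_maxwell_def)
    also have "maxwell_op S (\<lambda>y. Z' y t) x - maxwell_op S (\<lambda>y. Z y t) x =
      damping S (Z' x t - Z x t) + (\<Sum>j\<in>UNIV. flux (axis j 1) (pd j (\<lambda>y. Z' y t - Z y t) x))"
      unfolding maxwell_op_eq[OF d[OF t]] maxwell_op_eq[OF d'[OF t]] pd_diff[OF d'[OF t] d[OF t]]
      by (simp add: damping.diff flux.diff_right sum_subtractf)
    finally show "((\<lambda>s. Z' x s - Z x s) has_vector_derivative
      damping S (Z' x t - Z x t) + (\<Sum>j\<in>UNIV. flux (axis j 1) (pd j (\<lambda>y. Z' y t - Z y t) x))) (at t within T)" .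
  qed (rule t)
  then show ?thesis by simp
qed

lemma re_vec_cmat: "re_vec (cmat A *v u) = A *v re_vec u"
  by (simp add: vec_eq_iff re_vec_def cmat_def matrix_vector_mult_def map_matrix_def)

lemma curl_re_vec:
  assumes "F differentiable (at x)"
  shows "curl (\<lambda>y. re_vec (F y)) x = re_vec (curl F x)"
  by (simp only: vec_eq_iff forall_3 curl_def pd_bounded_linear[OF bounded_linear_re_vec assms])
    (simp add: re_vec_def)

lemma solves_real_maxwell_re_vec:
  assumes Z: "solves_maxwell S p T Z0 Z"
    and "\<And>x. E0 x = re_vec (upper (Z0 x))" "\<And>x. H0 x = re_vec (lower (Z0 x))"
  shows "solves_real_maxwell S p T E0 H0 (\<lambda>x t. re_vec (upper (Z x t))) (\<lambda>x t. re_vec (lower (Z x t)))"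
  unfolding solves_real_maxwell_def
proof (intro conjI allI ballI)
  note bl_up = bounded_linear_compose[OF bounded_linear_re_vec bounded_linear_upper]
    and bl_low = bounded_linear_compose[OF bounded_linear_re_vec bounded_linear_lower]
  show "C1_on (\<lambda>(x, t). re_vec (upper (Z x t))) (UNIV \<times> T)" "C1_on (\<lambda>(x, t). re_vec (lower (Z x t))) (UNIV \<times> T)"
    using Z C1_on_bounded_linear[OF bl_up] C1_on_bounded_linear[OF bl_low]
    unfolding solves_maxwell_def case_prod_unfold by blast+
  show "periodic p (\<lambda>x. re_vec (upper (Z x t)))" "periodic p (\<lambda>x. re_vec (lower (Z x t)))" if "t \<in> T" for t
    using Z that by (simp_all add: solves_maxwell_def periodic_def)
  show "re_vec (upper (Z x 0)) = E0 x" "re_vec (lower (Z x 0)) = H0 x" for x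
    using Z assms(2,3) by (simp_all add: solves_maxwell_def)
  fix x t assume t: "t \<in> T"
  have ode: "((\<lambda>s. Z x s) has_vector_derivative maxwell_op S (\<lambda>y. Z y t) x) (at t within T)"
    using Z t by (simp add: solves_maxwell_def)
  note d = solves_maxwell_differentiable[OF Z t, of x]
  have d_up: "(\<lambda>y. upper (Z y t)) differentiable (at x)"
    and d_low: "(\<lambda>y. lower (Z y t)) differentiable (at x)"
    using d bounded_linear.has_derivative[OF bounded_linear_upper] bounded_linear.has_derivative[OF bounded_linear_lower]
    unfolding differentiable_def by blast+
  interpret R: bounded_linear "re_vec :: complex^3 \<Rightarrow> real^3" by (rule bounded_linear_re_vec)
  show "((\<lambda>s. re_vec (upper (Z x s))) has_vector_derivative
      - (S *v re_vec (upper (Z x t))) + curl (\<lambda>y. re_vec (lower (Z y t))) x) (at t within T)"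
    using bounded_linear.has_vector_derivative[OF bl_up ode]
    by (simp add: maxwell_op_def R.add R.diff R.neg re_vec_cmat curl_re_vec[OF d_low])
  show "((\<lambda>s. re_vec (lower (Z x s))) has_vector_derivative - curl (\<lambda>y. re_vec (upper (Z y t))) x) (at t within T)"
    using bounded_linear.has_vector_derivative[OF bl_low ode]
    by (simp add: maxwell_op_def R.neg curl_re_vec[OF d_up])
qed

section \<open>Superposition of plane waves\<close>

text \<open>
  The space-time derivative at a point of a wave $e^{i x \cdot w} \zeta(t)$; \<open>g\<close> stands for \<open>i\<close> times its
  value and \<open>k\<close> for its time derivative there.
\<close>

definition plane_wave_derivative :: "real^3 \<Rightarrow> C6 \<Rightarrow> C6 \<Rightarrow> ((real^3) \<times> real) \<Rightarrow>\<^sub>L C6" where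
  "plane_wave_derivative w g k =
     (blinfun_scaleR_left g o\<^sub>L (blinfun_inner_left w o\<^sub>L fst_blinfun)) + (blinfun_scaleR_left k o\<^sub>L snd_blinfun)"

lemma plane_wave_derivative_apply [simp]:
  "blinfun_apply (plane_wave_derivative w g k) (h, r) = (h \<bullet> w) *\<^sub>R g + r *\<^sub>R k"
  by (simp add: plane_wave_derivative_def blinfun.add_left)

lemma norm_plane_wave_derivative: "norm (plane_wave_derivative w g k) \<le> norm w * norm g + norm k"
proof (rule norm_blinfun_bound)
  fix hr :: "(real^3) \<times> real"
  obtain h r where hr: "hr = (h, r)" by fastforce
  have "norm (plane_wave_derivative w g k hr) \<le> norm ((h \<bullet> w) *\<^sub>R g) + norm (r *\<^sub>R k)"
    unfolding hr plane_wave_derivative_apply by (rule norm_triangle_ineq)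
  also have "\<dots> \<le> (norm h * norm w) * norm g + norm r * norm k"
    by (simp add: mult_right_mono Cauchy_Schwarz_ineq2)
  also have "\<dots> \<le> (norm hr * norm w) * norm g + norm hr * norm k"
    using norm_fst_le[of h r] norm_snd_le[of r h] unfolding hr
    by (intro add_mono mult_right_mono) auto
  finally show "norm (plane_wave_derivative w g k hr) \<le> (norm w * norm g + norm k) * norm hr"
    by (simp add: algebra_simps)
qed simp

lemma continuous_on_plane_wave_derivative:
  assumes "continuous_on A g" "continuous_on A k"
  shows "continuous_on A (\<lambda>z. plane_wave_derivative w (g z) (k z))"
  unfolding plane_wave_derivative_def
  by (intro continuous_intros bounded_linear.continuous_on[OF bounded_linear_blinfun_scaleR_left] assms)

lemma flux_basis_sum: "(\<Sum>j\<in>UNIV. flux (axis j 1) (w $ j *\<^sub>R y)) = flux w y"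
proof -
  have "w = (\<Sum>j\<in>UNIV. w $ j *\<^sub>R axis j 1)"
    by (simp add: vec_eq_iff forall_3 sum_3 axis_def)
  then have "flux w y = flux (\<Sum>j\<in>UNIV. w $ j *\<^sub>R axis j 1) y" by simp
  then show ?thesis
    by (simp add: flux.sum_left flux.scaleR_left flux.scaleR_right)
qed

text \<open>
  The derivative of one wave is of size \<open>(|w| + 1) N w\<close>, up to a factor that is bounded on each time
  strip. So the series can be differentiated term by term on every strip, and the strips cover
  space-time.
\<close>

theorem superposition_solves_maxwell:
  fixes z :: "real^3 \<Rightarrow> real \<Rightarrow> C6"
  assumes W: "W \<subseteq> wave_vectors p"
    and ode: "\<And>w t. w \<in> W \<Longrightarrow>
      (z w has_vector_derivative (damping S (z w t) + \<i> *s flux w (z w t))) (at t)"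
    and growth: "\<And>w t. w \<in> W \<Longrightarrow> norm (z w t) \<le> N w * exp (K * \<bar>t\<bar>)"
    and N: "N summable_on W" "(\<lambda>w. norm w * N w) summable_on W"
  defines "f \<equiv> \<lambda>w x t. exp (\<i> * complex_of_real (x \<bullet> w)) *s z w t"
  defines "Z \<equiv> \<lambda>x t. \<Sum>\<^sub>\<infinity>w\<in>W. f w x t"
  shows "(\<lambda>w. f w x t) summable_on W"
    and "solves_maxwell S p UNIV (\<lambda>x. Z x 0) Z"
proof -
  interpret damping: bounded_linear "damping S" by (rule bounded_linear_damping)
  have norm_f: "norm (f w x t) = norm (z w t)" for w x t
    by (simp add: f_def)
  show summable: "(\<lambda>w. f w x t) summable_on W" for x t
  proof (rule abs_summable_summable, rule Infinite_Sum.abs_summable_on_comparison_test')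
    show "(\<lambda>w. N w * exp (K * \<bar>t\<bar>)) summable_on W"
      by (intro summable_on_cmult_left N)
    show "norm (f w x t) \<le> N w * exp (K * \<bar>t\<bar>)" if "w \<in> W" for w
      using growth[OF that] by (simp add: norm_f)
  qed
  define z' where "z' w t = damping S (z w t) + \<i> *s flux w (z w t)" for w t
  define ft where "ft w x t = exp (\<i> * complex_of_real (x \<bullet> w)) *s z' w t" for w x t
  define F where "F w = (\<lambda>(x, t). plane_wave_derivative w (\<i> *s f w x t) (ft w x t))" for w
  have z_deriv: "(z w has_vector_derivative z' w t) (at t)" if "w \<in> W" for w t
    using ode[OF that] by (simp add: z'_def)
  have z_cont: "continuous_on UNIV (z w)" if "w \<in> W" for w
    using z_deriv[OF that] has_vector_derivative_continuous continuous_at_imp_continuous_on by blast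
  have F_deriv: "((\<lambda>(x, t). f w x t) has_derivative blinfun_apply (F w (x, t))) (at (x, t) within U)"
    if "w \<in> W" for w x t U
  proof -
    have e: "((\<lambda>y. exp (\<i> * complex_of_real (fst y \<bullet> w))) has_derivative
        (\<lambda>h. \<i> * complex_of_real (fst h \<bullet> w) * exp (\<i> * complex_of_real (x \<bullet> w)))) (at (x, t) within U)"
    proof -
      have "((\<lambda>y. \<i> * complex_of_real (fst y \<bullet> w)) has_derivative (\<lambda>h. \<i> * complex_of_real (fst h \<bullet> w))) (at (x, t) within U)"
        by (intro has_derivative_mult_right has_derivative_of_real has_derivative_inner_left
            has_derivative_fst has_derivative_ident)
      from has_derivative_compose[OF this DERIV_exp[unfolded has_field_derivative_def]]
      show ?thesis
        by (simp add: mult.commute)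
    qed
    have "((\<lambda>y. z w (snd y)) has_derivative (\<lambda>h. snd h *\<^sub>R z' w t)) (at (x, t) within U)"
      using has_derivative_compose[of snd snd "(x, t)" U "z w" "\<lambda>r. r *\<^sub>R z' w t"] z_deriv[OF that, of t]
      by (simp add: has_vector_derivative_def has_derivative_snd[OF has_derivative_ident])
    from bounded_bilinear.FDERIV[OF bounded_bilinear_smult e this]
    show ?thesis
      unfolding f_def case_prod_unfold
      by (rule has_derivative_eq_rhs)
        (simp add: F_def ft_def f_def fun_eq_iff vec_eq_iff, simp add: scaleR_conv_of_real algebra_simps)
  qed
  have F_cont: "continuous_on U (F w)" if "w \<in> W" for w U
    unfolding F_def case_prod_unfold ft_def z'_def f_def
    by (intro continuous_on_plane_wave_derivative bounded_bilinear.continuous_on[OF bounded_bilinear_smult]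
        continuous_intros damping.continuous_on flux.continuous_on continuous_on_compose2[OF z_cont[OF that]]) auto
  obtain B where B: "B > 0" "\<And>y. norm (damping S y) \<le> norm y * B"
    using damping.pos_bounded by auto
  obtain C where C: "C > 0" "\<And>w y. norm (flux w y) \<le> norm w * norm y * C"
    using flux.pos_bounded by auto
  define M where "M R w = ((1 + C) * (norm w * N w) + B * N w) * exp (\<bar>K\<bar> * R)" for R :: real and w
  have M_summable: "M R summable_on W" for R
    unfolding M_def by (intro summable_on_cmult_left summable_on_add summable_on_cmult_right N)
  have F_bound: "norm (F w (x, t)) \<le> M R w" if w: "w \<in> W" and t: "\<bar>t\<bar> \<le> R" for w x t R
  proof -
    have "norm (F w (x, t)) \<le> norm w * norm (z w t) + norm (z' w t)"
      using norm_plane_wave_derivative[of w "\<i> *s f w x t" "ft w x t"]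
      by (simp add: F_def ft_def norm_f)
    also have "norm (z' w t) \<le> norm (z w t) * B + norm w * norm (z w t) * C"
      unfolding z'_def by (rule order_trans[OF norm_triangle_ineq add_mono]) (simp_all add: B C)
    also have "norm w * norm (z w t) + (norm (z w t) * B + norm w * norm (z w t) * C) =
        ((1 + C) * norm w + B) * norm (z w t)"
      by (simp add: algebra_simps)
    also have "\<dots> \<le> ((1 + C) * norm w + B) * (N w * exp (\<bar>K\<bar> * R))"
    proof (rule mult_left_mono)
      have "0 \<le> N w"
        using order_trans[OF norm_ge_zero growth[OF w, of 0]] by simp
      moreover have "K * \<bar>t\<bar> \<le> \<bar>K\<bar> * R"
        using t by (intro mult_mono) auto
      ultimately have "N w * exp (K * \<bar>t\<bar>) \<le> N w * exp (\<bar>K\<bar> * R)"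
        by (intro mult_left_mono) auto
      then show "norm (z w t) \<le> N w * exp (\<bar>K\<bar> * R)"
        using growth[OF w, of t] by simp
    qed (use B C in simp)
    also have "\<dots> = M R w"
      by (simp add: M_def algebra_simps)
    finally show ?thesis by simp
  qed
  define Z' where "Z' y = (\<Sum>\<^sub>\<infinity>w\<in>W. F w y)" for y
  have Z'_sum: "((\<lambda>w. F w (x, t)) has_sum Z' (x, t)) W" for x t
    unfolding Z'_def
    by (rule has_sum_infsum, rule abs_summable_summable,
        rule Infinite_Sum.abs_summable_on_comparison_test'[OF M_summable[of "\<bar>t\<bar>"]]) (simp add: F_bound)
  define U where "U R = (UNIV :: (real^3) set) \<times> {-R <..< R}" for R :: real
  have U: "open (U R)" "convex (U R)" for R
    unfolding U_def by (auto intro: open_Times convex_Times)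
  have mem_U: "(x, t) \<in> U (\<bar>t\<bar> + 1)" for x t
    by (auto simp: U_def)
  have U_bound: "norm (F w y) \<le> M R w" if "w \<in> W" "y \<in> U R" for w y R
    using F_bound[OF that(1), of "snd y" R "fst y"] that(2) by (auto simp: U_def)
  have Z_deriv: "((\<lambda>(x, t). Z x t) has_derivative blinfun_apply (Z' (x, t))) (at (x, t))" for x t
  proof -
    have "((\<lambda>y. \<Sum>\<^sub>\<infinity>w\<in>W. case y of (x, t) \<Rightarrow> f w x t) has_derivative blinfun_apply (\<Sum>\<^sub>\<infinity>w\<in>W. F w (x, t)))
        (at (x, t) within U (\<bar>t\<bar> + 1))"
      by (rule has_derivative_infsum[OF U(2) mem_U _ U_bound M_summable])
        (use F_deriv summable in auto)
    then show ?thesis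
      using at_within_open[OF mem_U U(1)] by (simp add: Z_def Z'_def case_prod_unfold)
  qed
  have Z'_cont: "continuous_on UNIV Z'"
  proof (intro continuous_at_imp_continuous_on ballI)
    fix y :: "(real^3) \<times> real"
    obtain x t where y: "y = (x, t)" by fastforce
    have "continuous_on (U (\<bar>t\<bar> + 1)) Z'"
      unfolding Z'_def by (rule continuous_on_infsum[OF F_cont U_bound M_summable])
    then show "isCont Z' y"
      using mem_U U(1) y by (simp add: continuous_on_eq_continuous_at)
  qed
  have pd_Z: "pd j (\<lambda>y. Z y t) x = Z' (x, t) (axis j 1, 0)"
    and diff_Z: "(\<lambda>y. Z y t) differentiable (at x)" for j x t
    using partial_derivative_space_time[of Z "blinfun_apply (Z' (x, t))" x t UNIV] Z_deriv
    by (auto simp: differentiable_def)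
  have time_Z: "((\<lambda>s. Z x s) has_vector_derivative Z' (x, t) (0, 1)) (at t)" for x t
  proof -
    have "((\<lambda>s. (x, s)) has_derivative (\<lambda>r. (0, r))) (at t)"
      by (auto intro!: derivative_eq_intros)
    from has_derivative_compose[OF this Z_deriv]
    have "((\<lambda>s. Z x s) has_derivative (\<lambda>r. Z' (x, t) (0, r))) (at t)" by simp
    moreover have "(\<lambda>r. Z' (x, t) (0, r)) = (\<lambda>r. r *\<^sub>R Z' (x, t) (0, 1))"
    proof
      show "Z' (x, t) (0, r) = r *\<^sub>R Z' (x, t) (0, 1)" for r
        using blinfun.scaleR_right[of "Z' (x, t)" r "(0, 1)"] by simp
    qed
    ultimately show ?thesis
      by (simp only: has_vector_derivative_def)
  qed
  have eq: "Z' (x, t) (0, 1) = maxwell_op S (\<lambda>y. Z y t) x" for x t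
  proof -
    have F_sum: "((\<lambda>w. F w (x, t) h) has_sum Z' (x, t) h) W" for h
      using has_sum_bounded_linear[OF blinfun.bounded_linear_left[of h] Z'_sum[of x t]] .
    have damping_sum: "((\<lambda>w. damping S (f w x t)) has_sum damping S (Z x t)) W"
      unfolding Z_def
      using has_sum_bounded_linear[OF bounded_linear_damping[of S] has_sum_infsum[OF summable[of x t]]] .
    have flux_sum: "((\<lambda>w. flux (axis j 1) (F w (x, t) (axis j 1, 0))) has_sum
        flux (axis j 1) (Z' (x, t) (axis j 1, 0))) W" for j
      using has_sum_bounded_linear[OF flux.bounded_linear_right[of "axis j 1"] F_sum[of "(axis j 1, 0)"]] .
    have "((\<lambda>w. damping S (f w x t) + (\<Sum>j\<in>UNIV. flux (axis j 1) (F w (x, t) (axis j 1, 0)))) has_sum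
        (damping S (Z x t) + (\<Sum>j\<in>UNIV. flux (axis j 1) (Z' (x, t) (axis j 1, 0))))) W"
      unfolding sum_3 by (intro has_sum_add damping_sum flux_sum)
    moreover have "damping S (f w x t) + (\<Sum>j\<in>UNIV. flux (axis j 1) (F w (x, t) (axis j 1, 0))) = F w (x, t) (0, 1)" for w
    proof -
      have "(\<Sum>j\<in>UNIV. flux (axis j 1) (F w (x, t) (axis j 1, 0))) = flux w (\<i> *s f w x t)"
        by (simp add: F_def inner_axis' flux_basis_sum)
      then show ?thesis
        by (simp add: F_def ft_def z'_def f_def damping_smult flux_smult vec.scale_right_distrib mult.commute)
    qed
    ultimately have "((\<lambda>w. F w (x, t) (0, 1)) has_sum
        (damping S (Z x t) + (\<Sum>j\<in>UNIV. flux (axis j 1) (Z' (x, t) (axis j 1, 0))))) W"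
      by simp
    then show ?thesis
      unfolding maxwell_op_eq[OF diff_Z] pd_Z using F_sum has_sum_unique by blast
  qed
  show "solves_maxwell S p UNIV (\<lambda>x. Z x 0) Z"
    unfolding solves_maxwell_def
  proof (intro conjI allI ballI)
    show "C1_on (\<lambda>(x, t). Z x t) (UNIV \<times> UNIV)"
      unfolding C1_on_def using Z_deriv Z'_cont by (intro exI[of _ Z']) auto
    show "((\<lambda>s. Z x s) has_vector_derivative maxwell_op S (\<lambda>y. Z y t) x) (at t)" for x t
      using time_Z by (simp add: eq)
    have "f w (x + p j) t = f w x t" if w: "w \<in> W" for w x t j
    proof -
      obtain n :: int where "w \<bullet> p j = 2 * pi * of_int n"
        using W w unfolding wave_vectors_def by blast
      then have "\<i> * complex_of_real ((x + p j) \<bullet> w) = \<i> * complex_of_real (x \<bullet> w) + \<i> * (of_int n * (of_real pi * 2))"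
        by (simp add: inner_add_left inner_commute algebra_simps)
      then show ?thesis
        unfolding f_def by (simp only: exp_plus_2pin)
    qed
    then show "periodic p (\<lambda>x. Z x t)" for t
      unfolding periodic_def Z_def by (intro allI infsum_cong)
  qed simp
qed


theorem theorem2p6:
  fixes S :: "real^3^3"
    and p :: "3 \<Rightarrow> real^3"
    and T :: "real set"
    and W :: "(real^3) set"
    and Z0 :: "real^3 \<Rightarrow> C6"
    and E0 H0 :: "real^3 \<Rightarrow> real^3"
    and X Y a b :: "real^3 \<Rightarrow> complex^3"
    and lam :: "real^3 \<Rightarrow> 6 \<Rightarrow> complex"
    and h :: "real^3 \<Rightarrow> 6 \<Rightarrow> C6"
  assumes periods: "inj p" "independent (range p)"
    and times: "is_interval T" "0 \<in> T"
    and wave_vecs: "W \<subseteq> wave_vectors p"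
    and Z0_periodic: "periodic p Z0"
    and Z0_series: "\<And>x. ((\<lambda>w. plane_wave w (X w) (Y w) x) has_sum Z0 x) W"
    and Z0_real_part: "\<And>x. E0 x = re_vec (upper (Z0 x))" "\<And>x. H0 x = re_vec (lower (Z0 x))"
    and X_coeffs: "\<And>w. w \<in> W \<Longrightarrow> X w = (\<Sum>d\<in>UNIV. a w $ d *s v d w)"
    and Y_coeffs: "\<And>w. w \<in> W \<Longrightarrow> Y w = (\<Sum>d\<in>UNIV. b w $ d *s v d w)"
    and decay: "(\<lambda>w. norm w * (\<Sum>d\<in>UNIV. cmod (a w $ d) + cmod (b w $ d))) summable_on W"
    and h_indep: "\<And>w. w \<in> W \<Longrightarrow> inj (h w) \<and> vec.independent (range (h w))"
    and h_eigen: "\<And>w k. w \<in> W \<Longrightarrow> eigen_eqs S w (lam w k) (h w k)"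
  shows "(\<forall>w\<in>W. \<exists>!c. \<forall>x. wave_mode w (lam w) (h w) c x 0 = plane_wave w (X w) (Y w) x) \<and>
    (\<forall>c. (\<forall>w\<in>W. \<forall>x. wave_mode w (lam w) (h w) (c w) x 0 = plane_wave w (X w) (Y w) x) \<longrightarrow>
      (let Zw = (\<lambda>w x t. wave_mode w (lam w) (h w) (c w) x t);
           Z = (\<lambda>x t. \<Sum>\<^sub>\<infinity>w\<in>W. Zw w x t)
       in (\<forall>x. \<forall>t\<in>T. (\<lambda>w. Zw w x t) summable_on W) \<and>
          solves_maxwell S p T Z0 Z \<and>
          (\<forall>Z'. solves_maxwell S p T Z0 Z' \<longrightarrow> (\<forall>x. \<forall>t\<in>T. Z' x t = Z x t)) \<and>
          solves_real_maxwell S p T E0 H0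
            (\<lambda>x t. re_vec (upper (Z x t))) (\<lambda>x t. re_vec (lower (Z x t)))))"
proof -
  have W_nonzero: "w \<noteq> 0" if "w \<in> W" for w
    using wave_vecs that by (auto simp: wave_vectors_def)
  have unique: "\<forall>w\<in>W. \<exists>!c. \<forall>x. wave_mode w (lam w) (h w) c x 0 = plane_wave w (X w) (Y w) x"
    using unique_initial_mode[OF W_nonzero _ _ X_coeffs Y_coeffs] h_indep by blast
  \<comment> \<open>The series solves the system for all real times; the time set \<open>T\<close> enters only through uniqueness.\<close>
  have solution: "(\<forall>x t. (\<lambda>w. wave_mode w (lam w) (h w) (c w) x t) summable_on W) \<and>
      solves_maxwell S p UNIV Z0 (\<lambda>x t. \<Sum>\<^sub>\<infinity>w\<in>W. wave_mode w (lam w) (h w) (c w) x t)"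
    if c: "\<forall>w\<in>W. \<forall>x. wave_mode w (lam w) (h w) (c w) x 0 = plane_wave w (X w) (Y w) x" for c
  proof -
    define z where "z w = amplitude w (lam w) (h w) (c w)" for w
    define N where "N w = (\<Sum>d\<in>UNIV. cmod (a w $ d) + cmod (b w $ d))" for w
    obtain K where K: "\<And>y. norm (damping S y) \<le> norm y * K"
      using bounded_linear.bounded[OF bounded_linear_damping] by blast
    have ode: "(z w has_vector_derivative (damping S (z w t) + \<i> *s flux w (z w t))) (at t)"
      if "w \<in> W" for w t
      unfolding z_def by (intro amplitude_ode W_nonzero h_eigen that)
    have init: "norm (z w 0) \<le> N w" if w: "w \<in> W" for w
    proof -
      have "z w 0 = blk (X w) (Y w)"
        using c w initial_mode_iff unfolding z_def by blast
      then have "norm (z w 0) \<le> norm (X w) + norm (Y w)"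
        using norm_blk by simp
      also have "\<dots> \<le> (\<Sum>d\<in>UNIV. cmod (a w $ d)) + (\<Sum>d\<in>UNIV. cmod (b w $ d))"
        unfolding X_coeffs[OF w] Y_coeffs[OF w]
        by (intro add_mono sum_norm_le) (simp_all add: norm_v W_nonzero w)
      also have "\<dots> = N w"
        by (simp add: N_def sum.distrib)
      finally show ?thesis .
    qed
    have growth: "norm (z w t) \<le> N w * exp (K * \<bar>t\<bar>)" if w: "w \<in> W" for w t
    proof -
      have "norm (z w t) \<le> norm (z w 0) * exp (K * \<bar>t\<bar>)"
        unfolding z_def by (rule amplitude_bound[OF W_nonzero[OF w] h_eigen[OF w] K])
      also have "\<dots> \<le> N w * exp (K * \<bar>t\<bar>)"
        using init[OF w] by (intro mult_right_mono) auto
      finally show ?thesis .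
    qed
    have decay': "(\<lambda>w. norm w * N w) summable_on W"
      using decay by (simp add: N_def)
    have N_nonneg: "0 \<le> N w" for w
      by (auto simp: N_def intro!: sum_nonneg)
    \<comment> \<open>Wave vectors have length at least \<open>1 / C\<close>, which removes the weight \<open>norm w\<close> from the decay condition.\<close>
    define C where "C = (\<Sum>j\<in>UNIV. norm (p j))"
    have "N w \<le> C * (norm w * N w)" if "w \<in> W" for w
    proof -
      have "1 * N w \<le> (C * norm w) * N w"
        unfolding C_def using that wave_vecs
        by (intro mult_right_mono wave_vectors_bounded_below[OF periods] N_nonneg) auto
      then show ?thesis by (simp add: mult_ac)
    qed
    then have N_summable: "N summable_on W"
      using N_nonneg by (intro summable_on_comparison_test[OF summable_on_cmult_right[OF decay', of C]]) auto
    have wave: "wave_mode w (lam w) (h w) (c w) x t = exp (\<i> * complex_of_real (x \<bullet> w)) *s z w t" for w x t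
      by (simp add: wave_mode_eq z_def)
    have "(\<Sum>\<^sub>\<infinity>w\<in>W. wave_mode w (lam w) (h w) (c w) x 0) = Z0 x" for x
    proof -
      have "(\<Sum>\<^sub>\<infinity>w\<in>W. wave_mode w (lam w) (h w) (c w) x 0) = (\<Sum>\<^sub>\<infinity>w\<in>W. plane_wave w (X w) (Y w) x)"
        using c by (intro infsum_cong) blast
      then show ?thesis
        using infsumI[OF Z0_series[of x]] by simp
    qed
    then show ?thesis
      using superposition_solves_maxwell[OF wave_vecs ode growth N_summable decay']
      unfolding wave by simp
  qed
  show ?thesis
  proof (intro conjI[OF unique] allI impI)
    fix c
    assume c: "\<forall>w\<in>W. \<forall>x. wave_mode w (lam w) (h w) (c w) x 0 = plane_wave w (X w) (Y w) x"
    define Z where "Z = (\<lambda>x t. \<Sum>\<^sub>\<infinity>w\<in>W. wave_mode w (lam w) (h w) (c w) x t)"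
    have Z: "solves_maxwell S p T Z0 Z"
      using solution[OF c] solves_maxwell_subset[of S p UNIV Z0 Z T] unfolding Z_def by simp
    have "Z' x t = Z x t" if "solves_maxwell S p T Z0 Z'" "t \<in> T" for Z' x t
      using solves_maxwell_unique[OF periods times Z that] .
    moreover have "solves_real_maxwell S p T E0 H0 (\<lambda>x t. re_vec (upper (Z x t))) (\<lambda>x t. re_vec (lower (Z x t)))"
      by (rule solves_real_maxwell_re_vec[OF Z Z0_real_part])
    ultimately show "let Zw = (\<lambda>w x t. wave_mode w (lam w) (h w) (c w) x t);
           Z = (\<lambda>x t. \<Sum>\<^sub>\<infinity>w\<in>W. Zw w x t)
       in (\<forall>x. \<forall>t\<in>T. (\<lambda>w. Zw w x t) summable_on W) \<and>
          solves_maxwell S p T Z0 Z \<and>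
          (\<forall>Z'. solves_maxwell S p T Z0 Z' \<longrightarrow> (\<forall>x. \<forall>t\<in>T. Z' x t = Z x t)) \<and>
          solves_real_maxwell S p T E0 H0
            (\<lambda>x t. re_vec (upper (Z x t))) (\<lambda>x t. re_vec (lower (Z x t)))"
      unfolding Let_def using solution[OF c] Z unfolding Z_def by blast
  qed
qed

end
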